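(* Let $\{n_k:k\geq0\}$ be a subsequence (strictly increasing sequence) of the positive integers with $\sup_kV(n_k)=\infty$. (a) Let $F\in H_{1/2}(G)$ be a martingale such that $$\omega_{H_{1/2}}\left(1/2^{|n_k|},F\right)=o\left(1/V^2(n_k)\right)\quad\text{as }k\to\infty.$$ Then $$\left\Vert\sigma_{n_k}F-F\right\Vert_{1/2}\rightarrow0\quad\text{as }k\to\infty.$$ (b) There exists a martingale $F\in H_{1/2}(G)$ for which $$\omega_{H_{1/2}}\left(1/2^{|n_k|},F\right)=O\left(1/V^2(n_k)\right)\quad\text{as }k\to\infty$$ and $$\left\Vert\sigma_{n_k}F-F\right\Vert_{1/2}\nrightarrow0\quad\text{as }k\to\infty.$$
   Context: $\mathbb{N}_+$ is the set of positive integers and $\mathbb{N}=\mathbb{N}_+\cup\{0\}$. $G=\prod_{j\in\mathbb{N}}Z_2$ is the Walsh (dyadic) group: the complete direct product of countably many copies of $Z_2=\{0,1\}$ (addition mod 2, discrete topology), with product topology and normalized Haar measure $\mu$. Elements are $x=(x_0,x_1,\dots)$ with $x_j\in\{0,1\}$. Put $I_0(x)=G$ and $I_n(x)=\{y\in G: y_0=x_0,\dots,y_{n-1}=x_{n-1}\}$. For $n\in\mathbb{N}_+$ write $n=\sum_{j\ge 0}n_j2^j$ with binary digits $n_j\in\{0,1\}$. (For a sequence of integers $\{n_k\}$, $n_k$ denotes the $k$-th term.) Put $|n|=\max\{j\in\mathbb{N}:n_j\neq0\}$. The variation of $n$ is $V(n)=n_0+\sum_{k=1}^\infty|n_k-n_{k-1}|$,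 where $n_k$ here denotes the binary digits of $n$. Rademacher functions: $r_k(x)=(-1)^{x_k}$. Walsh functions: $w_n(x)=\prod_{k\ge0}r_k(x)^{n_k}$, with $n_k$ the binary digits of $n$. Let $\zeta_n$ be the $\sigma$-algebra generated by the sets $I_n(x)$, $x\in G$. A martingale $F=(F_n,n\in\mathbb{N})$ is always with respect to $(\zeta_n)$; its maximal function is $F^*=\sup_n|F_n|$. For $0<p<\infty$, $\|f\|_p=\left(\int_G|f|^pd\mu\right)^{1/p}$, and $H_p(G)$ is the space of martingales with $\|F\|_{H_p}:=\|F^*\|_p<\infty$. The Walsh–Fourier coefficients of a martingale $F$ are $\widehat F(k)=\lim_{n\to\infty}\int_G F_nw_k\,d\mu$. Partial sums: $S_nF=\sum_{k=0}^{n-1}\widehat F(k)w_k$ (so $S_{2^n}F=F_n$); Fejér means: $\sigma_nF=\frac1n\sum_{k=1}^nS_kF$ ($n\in\mathbb{N}_+$). These are Walsh polynomials, i.e. functions on $G$. The modulus of continuity in $H_p(G)$ is $\omega_{H_p}(1/2^n,F):=\|F-S_{2^n}F\|_{H_p}$, where $F-S_{2^n}F$ is the martingale $(F_m-F_{\min(m,n)})_{m\in\mathbb{N}}$. In the expression $\|\sigma_nF-F\|_p$ (an $L_p$ quasi-norm of functions), $F$ denotes the a.e. limit function $\lim_{m\to\infty}F_m$, which exists a.e. for $F\in H_p(G)$. *)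

theory Defs
  imports "HOL-Probability.Probability" "HOL-Library.Landau_Symbols" "HOL-Library.Z2"
begin

type_synonym walsh_group = "nat \<Rightarrow> bit"

text \<open>
  The Haar probability measure of the compact group is the product of the
  uniform (Haar) probability measures of the factors \<open>Z\<^sub>2\<close>.
\<close>

definition haar :: "walsh_group measure" where
  "haar = (\<Pi>\<^sub>M j\<in>UNIV. uniform_count_measure (UNIV :: bit set))"

definition dyadic_interval :: "nat \<Rightarrow> walsh_group \<Rightarrow> walsh_group set" where
  "dyadic_interval n x = {y. \<forall>j<n. y j = x j}"

lemma space_haar [simp]: "space haar = UNIV"
  by (simp add: haar_def space_PiM space_uniform_count_measure)

definition dyadic_algebra :: "nat \<Rightarrow> walsh_group measure" where
  "dyadic_algebra n = sigma UNIV (range (dyadic_interval n))"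

lemma finite_UNIV_bit: "finite (UNIV :: bit set)"
proof -
  have "(UNIV :: bit set) = {0, 1}"
    by (auto intro: bit_not_zero_iff[THEN iffD1])
  then show ?thesis by (metis finite.simps)
qed

lemma prob_space_haar: "prob_space haar"
  unfolding haar_def
  by (intro prob_space_PiM prob_space_uniform_count_measure finite_UNIV_bit) auto

lemma subalgebra_dyadic_algebra: "subalgebra haar (dyadic_algebra n)"
proof -
  have "dyadic_interval n x \<in> sets haar" for x
  proof -
    have comp: "(\<lambda>y. y j) \<in> haar \<rightarrow>\<^sub>M uniform_count_measure UNIV" for j
      unfolding haar_def by (rule measurable_component_singleton) simp
    have "(\<lambda>y. y j) -` {x j} \<inter> space haar \<in> sets haar" for j
      by (rule measurable_sets[OF comp]) (simp add: sets_uniform_count_measure)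
    then have "{y \<in> space haar. \<forall>j\<in>{..<n}. y j = x j} \<in> sets haar"
      by (intro sets.sets_Collect_finite_All) (auto simp: vimage_def Int_def conj_commute)
    then show ?thesis by (simp add: dyadic_interval_def Ball_def)
  qed
  then show ?thesis
    unfolding subalgebra_def dyadic_algebra_def
    using sets.sigma_sets_subset[of "range (dyadic_interval n)" haar] by auto
qed

definition binary_digit :: "nat \<Rightarrow> nat \<Rightarrow> nat" where
  "binary_digit n j = (n div 2 ^ j) mod 2"

definition binary_order :: "nat \<Rightarrow> nat" where
  "binary_order n = Max {j. binary_digit n j \<noteq> 0}"

definition variation :: "nat \<Rightarrow> real" where
  "variation n = real (binary_digit n 0) +
     (\<Sum>j. \<bar>real (binary_digit n (Suc j)) - real (binary_digit n j)\<bar>)"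

definition rademacher :: "nat \<Rightarrow> walsh_group \<Rightarrow> real" where
  "rademacher k x = (if x k = 0 then 1 else -1)"

definition walsh :: "nat \<Rightarrow> walsh_group \<Rightarrow> real" where
  "walsh n x = (\<Prod>k. rademacher k x ^ binary_digit n k)"

text \<open>
  The library's \<^const>\<open>real_cond_exp\<close> covers real functions only. The following relation
  (\<open>g\<close> is a version of the conditional expectation of \<open>f\<close> given \<open>N\<close>)
  makes sense for real and complex functions alike.
\<close>

definition is_cond_exp ::
  "'a measure \<Rightarrow> 'a measure \<Rightarrow> ('a \<Rightarrow> 'b) \<Rightarrow> ('a \<Rightarrow> 'b::{banach, second_countable_topology}) \<Rightarrow> bool"
where
  "is_cond_exp M N f g \<longleftrightarrow>
     integrable M f \<and> integrable M g \<and> g \<in> borel_measurable N \<and>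
     (\<forall>A\<in>sets N. set_lebesgue_integral M A f = set_lebesgue_integral M A g)"

lemma is_cond_exp_imp_real_cond_exp:
  fixes f g :: "'a \<Rightarrow> real"
  assumes "sigma_finite_subalgebra M N" "is_cond_exp M N f g"
  shows "AE x in M. real_cond_exp M N f x = g x"
  using assms sigma_finite_subalgebra.real_cond_exp_charact[of M N f g]
  by (auto simp: is_cond_exp_def)

definition dyadic_martingale ::
  "(nat \<Rightarrow> walsh_group \<Rightarrow> 'a::{banach, second_countable_topology}) \<Rightarrow> bool" where
  "dyadic_martingale F \<longleftrightarrow>
     (\<forall>n m. n \<le> m \<longrightarrow> is_cond_exp haar (dyadic_algebra n) (F m) (F n))"

lemma dyadic_martingale_real_cond_exp:
  fixes F :: "nat \<Rightarrow> walsh_group \<Rightarrow> real"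
  assumes "dyadic_martingale F" "n \<le> m"
  shows "AE x in haar. real_cond_exp haar (dyadic_algebra n) (F m) x = F n x"
proof -
  interpret finite_measure_subalgebra haar "dyadic_algebra n"
    by (intro finite_measure_subalgebra.intro finite_measure_subalgebra_axioms.intro
          prob_space.axioms(1)[OF prob_space_haar] subalgebra_dyadic_algebra)
  show ?thesis
    using assms is_cond_exp_imp_real_cond_exp[OF sigma_finite_subalgebra_axioms]
    by (simp add: dyadic_martingale_def)
qed

text \<open>The power \<open>a\<^sup>p\<close> for \<open>p > 0\<close>, with \<open>\<infinity>\<^sup>p = \<infinity>\<close>.\<close>

definition ennreal_powr :: "ennreal \<Rightarrow> real \<Rightarrow> ennreal" where
  "ennreal_powr a p = (if a = \<top> then \<top> else ennreal (enn2real a powr p))"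

definition Lp_norm :: "real \<Rightarrow> (walsh_group \<Rightarrow> ennreal) \<Rightarrow> ennreal" where
  "Lp_norm p f = ennreal_powr (\<integral>\<^sup>+ x. ennreal_powr (f x) p \<partial>haar) (1 / p)"

definition maximal_function ::
  "(nat \<Rightarrow> walsh_group \<Rightarrow> 'a::real_normed_vector) \<Rightarrow> walsh_group \<Rightarrow> ennreal" where
  "maximal_function F x = (SUP n. ennreal (norm (F n x)))"

definition Hp_norm :: "real \<Rightarrow> (nat \<Rightarrow> walsh_group \<Rightarrow> 'a::real_normed_vector) \<Rightarrow> ennreal" where
  "Hp_norm p F = Lp_norm p (maximal_function F)"

definition hardy_space ::
  "real \<Rightarrow> (nat \<Rightarrow> walsh_group \<Rightarrow> 'a::{banach, second_countable_topology}) set" where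
  "hardy_space p = {F. dyadic_martingale F \<and> Hp_norm p F < \<top>}"

definition fourier_coeff ::
  "(nat \<Rightarrow> walsh_group \<Rightarrow> 'a::{banach, second_countable_topology}) \<Rightarrow> nat \<Rightarrow> 'a" where
  "fourier_coeff F k = lim (\<lambda>n. \<integral>x. walsh k x *\<^sub>R F n x \<partial>haar)"

definition partial_sum ::
  "nat \<Rightarrow> (nat \<Rightarrow> walsh_group \<Rightarrow> 'a::{banach, second_countable_topology}) \<Rightarrow> walsh_group \<Rightarrow> 'a"
where
  "partial_sum n F x = (\<Sum>k<n. walsh k x *\<^sub>R fourier_coeff F k)"

definition fejer_mean ::
  "nat \<Rightarrow> (nat \<Rightarrow> walsh_group \<Rightarrow> 'a::{banach, second_countable_topology}) \<Rightarrow> walsh_group \<Rightarrow> 'a"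
where
  "fejer_mean n F x = (1 / real n) *\<^sub>R (\<Sum>k=1..n. partial_sum k F x)"

text \<open>
  \<open>Hp_modulus p n F\<close> is the modulus of continuity \<open>\<omega>(1/2\<^sup>n, F)\<close>.
\<close>

definition Hp_modulus ::
  "real \<Rightarrow> nat \<Rightarrow> (nat \<Rightarrow> walsh_group \<Rightarrow> 'a::real_normed_vector) \<Rightarrow> ennreal" where
  "Hp_modulus p n F = Hp_norm p (\<lambda>m x. F m x - F (min m n) x)"

lemma ennreal_powr_mono:
  assumes "0 < p" "a \<le> b"
  shows "ennreal_powr a p \<le> ennreal_powr b p"
proof (cases "b = \<top>")
  case False
  with assms(2) have "a \<noteq> \<top>" by (auto simp: top_unique)
  moreover have "enn2real a \<le> enn2real b"
    using assms(2) False by (intro enn2real_mono) (auto simp: less_top)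
  ultimately show ?thesis
    using False assms(1) by (auto simp: ennreal_powr_def intro!: ennreal_leI powr_mono2)
qed (simp add: ennreal_powr_def)

lemma ennreal_powr_mult:
  assumes "0 < p" "0 < c"
  shows "ennreal_powr (ennreal c * a) p = ennreal (c powr p) * ennreal_powr a p"
proof (cases "a = \<top>")
  case True
  with assms show ?thesis by (simp add: ennreal_powr_def ennreal_mult_top)
next
  case False
  with assms show ?thesis
    by (auto simp: ennreal_powr_def ennreal_mult_eq_top_iff enn2real_mult powr_mult
          ennreal_mult' simp flip: less_top)
qed

lemma ennreal_powr_less_top_iff: "ennreal_powr a p < \<top> \<longleftrightarrow> a < \<top>"
  by (auto simp: ennreal_powr_def less_top)

text \<open>On Hardy spaces no information is lost by applying \<^const>\<open>enn2real\<close> to the modulus.\<close>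

lemma Hp_modulus_finite:
  assumes "0 < p" "F \<in> hardy_space p"
  shows "Hp_modulus p n F < \<top>"
proof -
  let ?D = "\<lambda>m x. F m x - F (min m n) x"
  have "maximal_function ?D x \<le> ennreal 2 * maximal_function F x" for x
    unfolding maximal_function_def
  proof (rule SUP_least)
    fix m
    have "ennreal (norm (?D m x)) \<le> ennreal (norm (F m x)) + ennreal (norm (F (min m n) x))"
      by (simp add: norm_triangle_ineq4 flip: ennreal_plus)
    also have "\<dots> \<le> (SUP m. ennreal (norm (F m x))) + (SUP m. ennreal (norm (F m x)))"
      by (intro add_mono SUP_upper) auto
    finally show "ennreal (norm (?D m x)) \<le> ennreal 2 * (SUP m. ennreal (norm (F m x)))"
      by (simp add: mult_2)
  qed
  then have "(\<integral>\<^sup>+ x. ennreal_powr (maximal_function ?D x) p \<partial>haar)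
      \<le> (\<integral>\<^sup>+ x. ennreal_powr (ennreal 2 * maximal_function F x) p \<partial>haar)"
    by (intro nn_integral_mono ennreal_powr_mono assms(1))
  also have "\<dots> = (\<integral>\<^sup>+ x. ennreal (2 powr p) * ennreal_powr (maximal_function F x) p \<partial>haar)"
    using assms(1) by (simp only: ennreal_powr_mult)
  also have "\<dots> < \<top>"
  proof -
    have fin: "(\<integral>\<^sup>+ x. ennreal_powr (maximal_function F x) p \<partial>haar) < \<top>"
      using assms(2) by (simp add: hardy_space_def Hp_norm_def Lp_norm_def ennreal_powr_less_top_iff)
    have [measurable]: "F m \<in> borel_measurable haar" for m
      using assms(2) unfolding hardy_space_def dyadic_martingale_def is_cond_exp_def
      by (blast intro: borel_measurable_integrable)
    have [measurable]: "maximal_function F \<in> borel_measurable haar"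
      unfolding maximal_function_def by measurable
    have "(\<lambda>x. ennreal_powr (maximal_function F x) p) \<in> borel_measurable haar"
      unfolding ennreal_powr_def by measurable
    from nn_integral_cmult[OF this] fin show ?thesis
      by (simp add: ennreal_mult_less_top)
  qed
  finally show ?thesis
    by (simp add: Hp_modulus_def Hp_norm_def Lp_norm_def ennreal_powr_less_top_iff)
qed

text \<open>
  At points where the martingale diverges \<^const>\<open>lim\<close> has an unspecified value;
  for \<open>F\<close> in a Hardy space these points form a null set.
\<close>

definition limit_function :: "(nat \<Rightarrow> walsh_group \<Rightarrow> 'a::real_normed_vector) \<Rightarrow> walsh_group \<Rightarrow> 'a"
where
  "limit_function F x = lim (\<lambda>m. F m x)"

end

theory Submission
  imports Defs
begin

text \<open>
  Let \<open>D\<^sub>k\<close> be the Walsh-Dirichlet kernels, \<open>T\<^sub>n = D\<^sub>1 + \<dots> + D\<^sub>n\<close> (so \<open>T\<^sub>n / n\<close> is the Fej\'er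
  kernel), \<open>r\<^sub>N\<close> the Rademacher functions and \<open>V\<close> the variation. Sizes are measured by the subadditive
  functional \<open>\<rho>(f) = \<integral>|f|\<^bsup>1/2\<^esup>\<close>, the square root of the \<open>L\<^bsub>1/2\<^esub>\<close> quasi-norm (\<^const>\<open>Lp_norm\<close>).

  A dyadic martingale satisfies \<open>F\<^bsub>N+1\<^esub> = F\<^sub>N + r\<^sub>N g\<^sub>N\<close> with \<open>g\<^sub>N\<close> depending on the first \<open>N\<close>
  coordinates only. For \<open>n = 2\<^sup>N + m\<close> with \<open>m < 2\<^sup>N\<close> the forward recursion of the kernels gives
  (\<open>fejer_mean_error\<close>)
    \<open>n (\<sigma>\<^sub>n F - F) = (2\<^sup>N \<sigma>\<^bsub>2^N\<^esub> F - 2\<^sup>N F\<^sub>N) + r\<^sub>N (T\<^sub>m * g\<^sub>N) + n (F\<^sub>N - F)\<close>.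
  The last term is dominated by the modulus of continuity. The first one obeys a recursion in \<open>N\<close> whose
  increments are controlled by \<open>\<rho>(g\<^sub>N)\<close>, and after division by \<open>2\<^bsup>N/2\<^esup>\<close> that recursion is a
  contraction; hence this term disappears in the limit once \<open>\<rho>(g\<^sub>N)\<close> tends to 0
  (\<open>root_mass_dyadic_error_tendsto_0\<close>). Only the middle term sees the binary digits of \<open>n\<close>. Since \<open>g\<^sub>N\<close> is
  a combination of \<open>2\<^sup>N\<close> indicators of intervals of length \<open>2\<^bsup>-N\<^esup>\<close>, subadditivity and translation
  invariance give \<open>\<rho>(T\<^sub>m * g\<^sub>N) \<le> 2\<^bsup>N/2\<^esup> \<rho>(T\<^sub>m) \<rho>(g\<^sub>N)\<close> (\<open>root_mass_convolution\<close>), with equality if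
  \<open>g\<^sub>N\<close> is a multiple of a single indicator.

  Everything therefore rests on the fact that \<open>\<rho>(T\<^sub>m)\<close> has the order of magnitude of \<open>V(m)\<close>, up to an
  additive constant.
  \<^item> Upper bound (\<open>root_mass_fejer_sum_le_transitions\<close>): complementing the digits of \<open>m\<close> below
    position \<open>a\<close>, that is passing from \<open>m\<close> to \<open>2\<^sup>a - 1 - m\<close>, changes \<open>T\<^sub>m\<close> by a unimodular factor
    and by summands with bounded \<open>\<rho>\<close>. If \<open>a - 1\<close> is the top digit, this strips off the whole leading
    block of ones, so that one jump in the digit sequence disappears at bounded cost.
  \<^item> Lower bound (\<open>root_mass_fejer_sum_ge_rises\<close>): if the digit of \<open>m\<close> at position \<open>j\<close> is 0 and the next
    higher one is 1, then there is a set of measure \<open>2\<^bsup>-j-2\<^esup>\<close> on which \<open>|T\<^sub>m| \<ge> 4\<^sup>j / 2\<close>, these sets are disjoint, and about half of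
    the variation comes from such positions.

  In the direction of convergence \<open>\<rho>(g\<^sub>N)\<close> is at most the square root of the modulus at \<open>N = |n|\<close>, so
  that the error is \<open>o(1)\<close>. The hypothesis also forces the tails \<open>sup\<^sub>m |F\<^sub>m - F\<^bsub>min(m,N)\<^esub>|\<close> to be
  small in \<open>L\<^bsub>1/2\<^esub>\<close> along a sequence of \<open>N\<close>, and this alone makes \<open>F\<^sub>m\<close> a Cauchy sequence almost
  everywhere, for values in any Banach space.

  For the counterexample choose indices \<open>k\<close> at which \<open>V(n\<^sub>k)\<close> is a record among all \<open>n\<^sub>j\<close> with
  \<open>|n\<^sub>j| \<le> |n\<^sub>k|\<close>, with \<open>V\<close> at least doubling from each choice to the next, and let \<open>g\<^sub>N\<close>, for
  \<open>N = |n\<^sub>k|\<close>, be the multiple of the indicator of \<open>I\<^sub>N(0)\<close> with \<open>\<rho>(g\<^sub>N) = 1 / V(n\<^sub>k)\<close>, all other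
  \<open>g\<^sub>N\<close> being 0. Doubling makes the tails geometric, the record property bounds the modulus at every
  \<open>n\<^sub>j\<close> and not only at the chosen ones, and the middle term keeps \<open>\<rho>\<close> bounded below at the chosen ones.
\<close>

section \<open>Functions of finitely many coordinates\<close>

definition cylinder :: "nat \<Rightarrow> (walsh_group \<Rightarrow> 'b) \<Rightarrow> bool" where
  "cylinder N f \<longleftrightarrow> (\<forall>x y. (\<forall>j<N. x j = y j) \<longrightarrow> f x = f y)"

text \<open>
  A finite group of representatives of the dyadic intervals of rank \<open>N\<close>: integrals of functions of
  \<open>N\<close> coordinates become finite averages over it.
\<close>

definition cube :: "nat \<Rightarrow> walsh_group set" where
  "cube N = {v. \<forall>j\<ge>N. v j = 0}"

definition truncate :: "nat \<Rightarrow> walsh_group \<Rightarrow> walsh_group" where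
  "truncate N x = (\<lambda>j. if j < N then x j else 0)"

definition gplus :: "walsh_group \<Rightarrow> walsh_group \<Rightarrow> walsh_group" (infixl "\<oplus>" 65) where
  "x \<oplus> y = (\<lambda>j. x j + y j)"

lemma cylinderD: "cylinder N f \<Longrightarrow> (\<And>j. j < N \<Longrightarrow> x j = y j) \<Longrightarrow> f x = f y"
  by (auto simp: cylinder_def)

lemma cylinder_mono: "cylinder N f \<Longrightarrow> N \<le> M \<Longrightarrow> cylinder M f"
  unfolding cylinder_def by (meson order_less_le_trans)

lemma cylinder_const [simp]: "cylinder N (\<lambda>x. c)"
  by (simp add: cylinder_def)

lemma cylinder_comp: "cylinder N f \<Longrightarrow> cylinder N (\<lambda>x. h (f x))"
  unfolding cylinder_def by metis

lemma cylinder_comp2: "cylinder N f \<Longrightarrow> cylinder N g \<Longrightarrow> cylinder N (\<lambda>x. h (f x) (g x))"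
  unfolding cylinder_def by metis

lemma cylinder_sum: "(\<And>i. i \<in> A \<Longrightarrow> cylinder N (f i)) \<Longrightarrow> cylinder N (\<lambda>x. \<Sum>i\<in>A. f i x)"
  unfolding cylinder_def by (auto intro!: sum.cong)

lemma cylinder_translate: "cylinder N f \<Longrightarrow> cylinder N (\<lambda>v. f (x \<oplus> v))"
  unfolding cylinder_def gplus_def by simp

lemma cylinder_dyadic_interval: "cylinder N (indicator (dyadic_interval N x))"
  by (auto simp: cylinder_def dyadic_interval_def indicator_def)

lemma gplus_commute: "x \<oplus> y = y \<oplus> x"
  unfolding gplus_def by (subst add.commute) (rule refl)

lemma gplus_cancel [simp]: "x \<oplus> (x \<oplus> y) = y"
proof
  fix j show "(x \<oplus> (x \<oplus> y)) j = y j"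
    by (cases "x j"; cases "y j") (simp_all add: gplus_def)
qed

lemma truncate_in_cube [simp]: "truncate N x \<in> cube N"
  by (simp add: truncate_def cube_def)

lemma truncate_eqI: "v \<in> cube N \<Longrightarrow> (\<And>j. j < N \<Longrightarrow> v j = x j) \<Longrightarrow> v = truncate N x"
  by (auto simp: truncate_def cube_def fun_eq_iff)

lemma cylinder_truncate: "cylinder N f \<Longrightarrow> f (truncate N x) = f x"
  by (erule cylinderD) (simp add: truncate_def)

lemma cube_0: "cube 0 = {\<lambda>_. 0}"
  by (auto simp: cube_def)

lemma cube_Suc: "cube (Suc N) = cube N \<union> (\<lambda>v. v(N := 1)) ` cube N"
proof (intro equalityI subsetI)
  fix v assume v: "v \<in> cube (Suc N)"
  show "v \<in> cube N \<union> (\<lambda>v. v(N := 1)) ` cube N"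
  proof (cases "v N = 0")
    case True
    then have "v j = 0" if "j \<ge> N" for j
      using v that by (cases "j = N") (auto simp: cube_def)
    then show ?thesis by (simp add: cube_def)
  next
    case False
    have "v(N := 0) \<in> cube N" using v by (auto simp: cube_def)
    moreover have "v = (v(N := 0))(N := 1)" using False by (auto simp: fun_eq_iff)
    ultimately show ?thesis by blast
  qed
qed (auto simp: cube_def)

lemma cube_Suc_disjoint: "cube N \<inter> (\<lambda>v. v(N := 1)) ` cube N = {}"
proof -
  have False if "v(N := 1) \<in> cube N" for v :: walsh_group
  proof -
    have "(v(N := 1)) N = 0" using that unfolding cube_def by blast
    then show False by simp
  qed
  then show ?thesis by auto
qed

lemma inj_on_cube_upd: "inj_on (\<lambda>v. v(N := 1)) (cube N)"
proof (rule inj_onI)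
  fix v w :: walsh_group
  assume v: "v \<in> cube N" and w: "w \<in> cube N" and eq: "v(N := 1) = w(N := 1)"
  show "v = w"
  proof
    fix j show "v j = w j"
      using v w fun_cong[OF eq, of j] by (cases "j = N") (auto simp: cube_def)
  qed
qed

lemma finite_cube [simp]: "finite (cube N)"
  by (induction N) (auto simp: cube_0 cube_Suc)

lemma sum_cube_Suc:
  "(\<Sum>v\<in>cube (Suc N). f v) = (\<Sum>v\<in>cube N. f v) + (\<Sum>v\<in>cube N. f (v(N := 1)))"
  unfolding cube_Suc
  by (subst sum.union_disjoint) (auto simp: cube_Suc_disjoint sum.reindex[OF inj_on_cube_upd])

lemma sets_dyadic_interval [measurable, simp]: "dyadic_interval N x \<in> sets haar"
  using subalgebra_dyadic_algebra[of N]
  by (auto simp: subalgebra_def dyadic_algebra_def)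

lemma emeasure_dyadic_interval: "emeasure haar (dyadic_interval N x) = ennreal (1 / 2 ^ N)"
proof -
  let ?B = "uniform_count_measure (UNIV :: bit set)"
  have UNIV_bit: "(UNIV :: bit set) = {0, 1}"
    by (auto intro: bit_not_zero_iff[THEN iffD1])
  have card_bit: "card (UNIV :: bit set) = 2"
    unfolding UNIV_bit by simp
  have "prob_space ?B"
    by (intro prob_space_uniform_count_measure finite_UNIV_bit) auto
  then have prod: "product_prob_space (\<lambda>_::nat. ?B)"
    by (intro product_prob_space.intro product_sigma_finite.intro
        product_prob_space_axioms.intro prob_space_imp_sigma_finite)
  have half: "emeasure ?B {b} = ennreal (1 / 2)" for b
    by (simp add: emeasure_uniform_count_measure finite_UNIV_bit card_bit)
  have "dyadic_interval N x = prod_emb UNIV (\<lambda>_. ?B) {..<N} (Pi\<^sub>E {..<N} (\<lambda>j. {x j}))"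
    unfolding dyadic_interval_def prod_emb_def
    by (intro set_eqI) (auto simp: space_uniform_count_measure restrict_PiE_iff Pi_iff)
  then have "emeasure haar (dyadic_interval N x) = (\<Prod>j<N. emeasure ?B {x j})"
    unfolding haar_def
    by (simp add: product_prob_space.emeasure_PiM_emb[OF prod] sets_uniform_count_measure)
  also have "\<dots> = ennreal (1 / 2 ^ N)"
    unfolding half by (subst prod_ennreal) (simp_all add: power_one_over)
  finally show ?thesis .
qed

lemma measure_dyadic_interval: "measure haar (dyadic_interval N x) = 1 / 2 ^ N"
  by (simp add: measure_def emeasure_dyadic_interval)

lemma cylinder_expansion:
  fixes f :: "walsh_group \<Rightarrow> 'b::real_vector"
  assumes "cylinder N f"
  shows "f x = (\<Sum>v\<in>cube N. indicator (dyadic_interval N v) x *\<^sub>R f v)"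
proof -
  have "indicator (dyadic_interval N v) x *\<^sub>R f v = (if v = truncate N x then f x else 0)"
    if "v \<in> cube N" for v
  proof (cases "x \<in> dyadic_interval N v")
    case True
    then have "v = truncate N x"
      by (intro truncate_eqI that) (auto simp: dyadic_interval_def)
    with True show ?thesis by (simp add: cylinder_truncate[OF assms])
  next
    case False
    then have "v \<noteq> truncate N x"
      by (auto simp: dyadic_interval_def truncate_def)
    with False show ?thesis by simp
  qed
  then show ?thesis by (simp cong: sum.cong)
qed

lemma
  fixes f :: "walsh_group \<Rightarrow> 'b::{banach, second_countable_topology}"
  assumes "cylinder N f"
  shows integrable_cylinder: "integrable haar f"
    and integral_cylinder: "(LINT v|haar. f v) = (1 / 2 ^ N) *\<^sub>R (\<Sum>v\<in>cube N. f v)"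
proof -
  interpret prob_space haar by (rule prob_space_haar)
  have eq: "f = (\<lambda>x. \<Sum>v\<in>cube N. indicator (dyadic_interval N v) x *\<^sub>R f v)"
    using cylinder_expansion[OF assms] by (rule ext)
  have int: "integrable haar (\<lambda>x. indicator (dyadic_interval N v) x *\<^sub>R f v)" for v
    by (intro integrable_scaleR_left) (simp add: emeasure_eq_measure)
  show "integrable haar f"
    by (subst eq) (intro Bochner_Integration.integrable_sum int)
  have "(LINT x|haar. f x) = (\<Sum>v\<in>cube N. LINT x|haar. indicator (dyadic_interval N v) x *\<^sub>R f v)"
    by (subst (1) eq) (intro Bochner_Integration.integral_sum int)
  also have "\<dots> = (\<Sum>v\<in>cube N. (1 / 2 ^ N) *\<^sub>R f v)"
    by (intro sum.cong refl) (simp add: measure_dyadic_interval emeasure_eq_measure)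
  finally show "(LINT v|haar. f v) = (1 / 2 ^ N) *\<^sub>R (\<Sum>v\<in>cube N. f v)"
    by (simp add: scaleR_sum_right)
qed

lemma measurable_cylinder:
  fixes f :: "walsh_group \<Rightarrow> 'b::{banach, second_countable_topology}"
  shows "cylinder N f \<Longrightarrow> f \<in> borel_measurable haar"
  by (rule borel_measurable_integrable) (rule integrable_cylinder)

text \<open>
  Translation by \<open>x\<close> acts on functions of \<open>N\<close> coordinates like translation by its truncation,
  which permutes the cube.
\<close>

lemma integral_translate:
  fixes f :: "walsh_group \<Rightarrow> 'b::{banach, second_countable_topology}"
  assumes "cylinder N f"
  shows "(LINT v|haar. f (x \<oplus> v)) = (LINT v|haar. f v)"
proof -
  define y where "y = truncate N x"
  have "(\<Sum>v\<in>cube N. f (x \<oplus> v)) = (\<Sum>v\<in>cube N. f v)"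
  proof (rule sum.reindex_bij_witness[of _ "\<lambda>v. y \<oplus> v" "\<lambda>v. y \<oplus> v"])
    show "y \<oplus> v \<in> cube N" if "v \<in> cube N" for v
      using that by (simp add: y_def cube_def gplus_def truncate_def)
    then show "y \<oplus> v \<in> cube N" if "v \<in> cube N" for v
      using that .
    show "f (y \<oplus> v) = f (x \<oplus> v)" for v
      by (rule cylinderD[OF assms]) (simp add: y_def gplus_def truncate_def)
  qed simp_all
  then show ?thesis
    by (simp add: integral_cylinder[OF assms] integral_cylinder[OF cylinder_translate[OF assms]])
qed

text \<open>
  Fubini for the coordinate \<open>N\<close>. It is the source of all recursions in \<open>N\<close> below.
\<close>

lemma integral_cylinder_Suc:
  fixes f :: "walsh_group \<Rightarrow> 'b::{banach, second_countable_topology}"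
  assumes "cylinder (Suc N) f"
  shows "(LINT v|haar. f v) = (1 / 2) *\<^sub>R ((LINT v|haar. f (v(N := 0))) + (LINT v|haar. f (v(N := 1))))"
proof -
  have c: "cylinder N (\<lambda>v. f (v(N := b)))" for b
    using assms unfolding cylinder_def by auto
  have 0: "f (v(N := 0)) = f v" if "v \<in> cube N" for v
    using that by (intro cylinderD[OF assms]) (auto simp: cube_def)
  show ?thesis
    by (simp add: integral_cylinder[OF assms] integral_cylinder[OF c] sum_cube_Suc 0
        scaleR_add_right cong: sum.cong)
qed

lemma rademacher_simps [simp]:
  "rademacher N (v(N := b)) = (if b = 0 then 1 else -1)" "\<bar>rademacher N x\<bar> = 1"
  "rademacher N x * rademacher N x = 1" "norm (rademacher N x) = 1"
  by (simp_all add: rademacher_def)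

lemma cylinder_rademacher: "k < N \<Longrightarrow> cylinder N (rademacher k)"
  by (auto simp: cylinder_def rademacher_def)

lemma cylinder_fun_upd: "cylinder N f \<Longrightarrow> f (v(N := b)) = f v"
  by (rule cylinderD) auto

lemma integral_rademacher_cylinder:
  fixes f :: "walsh_group \<Rightarrow> 'b::{banach, second_countable_topology}"
  assumes "cylinder N f"
  shows "(LINT v|haar. rademacher N v *\<^sub>R f v) = 0"
proof -
  have "cylinder (Suc N) (\<lambda>v. rademacher N v *\<^sub>R f v)"
    by (intro cylinder_comp2[where h = scaleR] cylinder_rademacher cylinder_mono[OF assms]) auto
  from integral_cylinder_Suc[OF this] show ?thesis
    by (simp add: cylinder_fun_upd[OF assms])
qed

lemma rademacher_gplus: "rademacher k (x \<oplus> y) = rademacher k x * rademacher k y"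
  by (cases "x k"; cases "y k") (auto simp: rademacher_def gplus_def)

section \<open>Binary digits and Walsh functions\<close>

lemma binary_digit_small: "n < 2 ^ N \<Longrightarrow> N \<le> j \<Longrightarrow> binary_digit n j = 0"
  unfolding binary_digit_def
  by (metis div_less less_le_trans mod_0 one_le_numeral power_increasing)

lemma binary_digit_add_low:
  assumes "j < N"
  shows "binary_digit (2 ^ N + m) j = binary_digit m j"
proof -
  have eq: "(2::nat) ^ N = 2 ^ (N - Suc j) * 2 * 2 ^ j"
  proof -
    have "N = (N - Suc j) + 1 + j" using assms by simp
    then show ?thesis by (metis power_add power_one_right)
  qed
  have "(2 ^ N + m) div 2 ^ j = 2 ^ (N - Suc j) * 2 + m div 2 ^ j"
    unfolding eq by (simp add: div_mult_self3)
  then show ?thesis by (simp add: binary_digit_def)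
qed

lemma binary_digit_add_top: "m < 2 ^ N \<Longrightarrow> binary_digit (2 ^ N + m) N = 1"
  by (simp add: binary_digit_def)

lemma binary_digit_le_1: "binary_digit n j = 0 \<or> binary_digit n j = 1"
  by (auto simp: binary_digit_def)

lemma obtain_top_digit:
  assumes "0 < (n::nat)"
  obtains N m where "n = 2 ^ N + m" "m < 2 ^ N"
proof -
  obtain N where "2 ^ N \<le> n" "n < 2 ^ (N + 1)"
    using ex_power_ivl1[of 2 n] assms by auto
  then show ?thesis by (intro that[of N "n - 2 ^ N"]) auto
qed

lemma binary_digit_complement:
  "n < 2 ^ a \<Longrightarrow> j < a \<Longrightarrow> binary_digit (2 ^ a - 1 - n) j = 1 - binary_digit n j"
proof (induction a arbitrary: n)
  case (Suc a)
  show ?case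
  proof (cases "n < 2 ^ a")
    case True
    then have eq: "2 ^ Suc a - 1 - n = 2 ^ a + (2 ^ a - 1 - n)" by auto
    show ?thesis
    proof (cases "j = a")
      case True
      have "2 ^ a - 1 - n < 2 ^ a" by (simp add: less_imp_diff_less)
      with \<open>n < 2 ^ a\<close> show ?thesis
        unfolding eq True by (simp only: binary_digit_add_top binary_digit_small[OF _ order_refl])
    next
      case False
      with Suc.prems have "j < a" by simp
      with Suc.IH[OF True] show ?thesis unfolding eq by (simp only: binary_digit_add_low)
    qed
  next
    case False
    define m where "m = n - 2 ^ a"
    have n: "n = 2 ^ a + m" and m: "m < 2 ^ a" using False Suc.prems by (auto simp: m_def)
    have eq: "2 ^ Suc a - 1 - n = 2 ^ a - 1 - m" using n by auto
    show ?thesis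
    proof (cases "j = a")
      case True
      have "2 ^ a - 1 - m < 2 ^ a" by (simp add: less_imp_diff_less)
      then show ?thesis unfolding eq unfolding n True
        using m by (simp only: binary_digit_add_top binary_digit_small[OF _ order_refl])
    next
      case False
      with Suc.prems have "j < a" by simp
      with Suc.IH[OF m] show ?thesis unfolding eq unfolding n by (simp only: binary_digit_add_low)
    qed
  qed
qed simp

lemma walsh_finite:
  assumes "n < 2 ^ N"
  shows "walsh n x = (\<Prod>k<N. rademacher k x ^ binary_digit n k)"
  unfolding walsh_def
  by (rule prodinf_finite) (auto simp: binary_digit_small[OF assms])

lemma walsh_0 [simp]: "walsh 0 x = 1"
  using walsh_finite[of 0 0] by simp

lemma walsh_add:
  assumes "m < 2 ^ N"
  shows "walsh (2 ^ N + m) x = rademacher N x * walsh m x"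
proof -
  have "walsh (2 ^ N + m) x = (\<Prod>k<Suc N. rademacher k x ^ binary_digit (2 ^ N + m) k)"
    using assms by (intro walsh_finite) simp
  also have "\<dots> = rademacher N x * (\<Prod>k<N. rademacher k x ^ binary_digit m k)"
    using assms by (simp add: binary_digit_add_low binary_digit_add_top)
  finally show ?thesis by (simp add: walsh_finite[OF assms])
qed

lemma abs_walsh: "\<bar>walsh n x\<bar> = 1"
proof -
  have "n < 2 ^ n" by simp
  from walsh_finite[OF this] show ?thesis by (simp add: abs_prod power_abs)
qed

lemma walsh_gplus: "walsh n (x \<oplus> y) = walsh n x * walsh n y"
proof -
  have "n < 2 ^ n" by simp
  from walsh_finite[OF this] show ?thesis
    by (simp add: rademacher_gplus power_mult_distrib prod.distrib)
qed

lemma cylinder_walsh: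
  assumes "n < 2 ^ N"
  shows "cylinder N (walsh n)"
  unfolding cylinder_def
proof (intro allI impI)
  fix x y :: walsh_group
  assume "\<forall>j<N. x j = y j"
  then show "walsh n x = walsh n y"
    unfolding walsh_finite[OF assms]
    by (intro prod.cong refl arg_cong2[where f = "(^)"]) (auto simp: rademacher_def)
qed

text \<open>
  The digits of \<open>2\<^sup>a - 1 - m\<close> are the complements of those of \<open>m\<close>, so \<open>2\<^sup>a - 1\<close> is their
  digitwise sum modulo 2.
\<close>

lemma walsh_reflect:
  "m < 2 ^ a \<Longrightarrow> walsh (2 ^ a - 1 - m) x = walsh (2 ^ a - 1) x * walsh m x"
proof (induction a arbitrary: m)
  case (Suc a)
  have "(2::nat) ^ Suc a - 1 = 2 ^ a + (2 ^ a - 1)" by simp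
  moreover have "(2::nat) ^ a - 1 < 2 ^ a" by simp
  ultimately have top: "walsh (2 ^ Suc a - 1) x = rademacher a x * walsh (2 ^ a - 1) x"
    by (simp only: walsh_add)
  show ?case
  proof (cases "m < 2 ^ a")
    case True
    then have eq: "2 ^ Suc a - 1 - m = 2 ^ a + (2 ^ a - 1 - m)" by auto
    have "2 ^ a - 1 - m < 2 ^ a" by (simp add: less_imp_diff_less)
    with Suc.IH[OF True] show ?thesis
      unfolding eq top by (simp add: walsh_add)
  next
    case False
    define l where "l = m - 2 ^ a"
    have m: "m = 2 ^ a + l" and l: "l < 2 ^ a" using False Suc.prems by (auto simp: l_def)
    have eq: "2 ^ Suc a - 1 - m = 2 ^ a - 1 - l" using m by auto
    have "walsh (2 ^ a - 1 - l) x
        = (rademacher a x * rademacher a x) * (walsh (2 ^ a - 1) x * walsh l x)"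
      using Suc.IH[OF l] by simp
    then show ?thesis
      unfolding eq top unfolding m walsh_add[OF l] by (simp only: ac_simps)
  qed
qed simp

section \<open>Dirichlet and Fej\'er kernels\<close>

definition dirichlet :: "nat \<Rightarrow> walsh_group \<Rightarrow> real" where
  "dirichlet n x = (\<Sum>j<n. walsh j x)"

text \<open>
  This is \<open>n\<close> times the Fej\'er kernel, since the 0th Dirichlet kernel vanishes. Without the factor
  \<open>1 / n\<close> the recursions are exact.
\<close>

definition fejer_sum :: "nat \<Rightarrow> walsh_group \<Rightarrow> real" where
  "fejer_sum n x = (\<Sum>k\<le>n. dirichlet k x)"

lemma dirichlet_0 [simp]: "dirichlet 0 x = 0"
  and dirichlet_Suc: "dirichlet (Suc n) x = dirichlet n x + walsh n x"
  and fejer_sum_0 [simp]: "fejer_sum 0 x = 0"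
  and fejer_sum_Suc: "fejer_sum (Suc n) x = fejer_sum n x + dirichlet (Suc n) x"
  by (simp_all add: dirichlet_def fejer_sum_def)

lemma cylinder_dirichlet: "n \<le> 2 ^ N \<Longrightarrow> cylinder N (dirichlet n)"
  unfolding dirichlet_def by (intro cylinder_sum cylinder_walsh) auto

lemma cylinder_fejer_sum: "n \<le> 2 ^ N \<Longrightarrow> cylinder N (fejer_sum n)"
  unfolding fejer_sum_def by (intro cylinder_sum cylinder_dirichlet) auto

lemma dirichlet_add:
  "m \<le> 2 ^ N \<Longrightarrow> dirichlet (2 ^ N + m) x = dirichlet (2 ^ N) x + rademacher N x * dirichlet m x"
  by (induction m) (simp_all add: dirichlet_Suc walsh_add distrib_left)

lemma dirichlet_reflect:
  "m \<le> 2 ^ a \<Longrightarrow> dirichlet (2 ^ a - m) x = dirichlet (2 ^ a) x - walsh (2 ^ a - 1) x * dirichlet m x"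
proof (induction m)
  case (Suc m)
  then have "2 ^ a - m = Suc (2 ^ a - Suc m)" by simp
  then have "dirichlet (2 ^ a - m) x = dirichlet (2 ^ a - Suc m) x + walsh (2 ^ a - 1 - m) x"
    by (simp add: dirichlet_Suc)
  with Suc walsh_reflect[of m a x] show ?case by (simp add: dirichlet_Suc algebra_simps)
qed simp

lemma dirichlet_pow2: "dirichlet (2 ^ N) x = 2 ^ N * indicator (dyadic_interval N (\<lambda>_. 0)) x"
proof (induction N)
  case 0
  show ?case by (simp add: dirichlet_def dyadic_interval_def lessThan_Suc)
next
  case (Suc N)
  have "dirichlet (2 ^ Suc N) x = (1 + rademacher N x) * dirichlet (2 ^ N) x"
    using dirichlet_add[of "2 ^ N" N x] by (simp add: algebra_simps mult_2)
  also have "\<dots> = 2 ^ Suc N * indicator (dyadic_interval (Suc N) (\<lambda>_. 0)) x"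
    unfolding Suc by (auto simp: indicator_def dyadic_interval_def rademacher_def less_Suc_eq)
  finally show ?case .
qed

lemma fejer_sum_add:
  "m \<le> 2 ^ N \<Longrightarrow> fejer_sum (2 ^ N + m) x
     = fejer_sum (2 ^ N) x + real m * dirichlet (2 ^ N) x + rademacher N x * fejer_sum m x"
proof (induction m)
  case (Suc m)
  then show ?case
    using dirichlet_add[of "Suc m" N x] by (simp add: fejer_sum_Suc algebra_simps)
qed simp

lemma fejer_sum_pow2_Suc:
  "fejer_sum (2 ^ Suc N) x
     = (1 + rademacher N x) * fejer_sum (2 ^ N) x + 2 ^ N * dirichlet (2 ^ N) x"
  using fejer_sum_add[of "2 ^ N" N x] by (simp add: algebra_simps mult_2)

text \<open>
  The digit complement \<open>m \<mapsto> 2\<^sup>a - 1 - m\<close> replaces the kernel by a unimodular multiple of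
  itself, up to two summands that do not depend on the digits of \<open>m\<close>. The shift by one is what turns
  the reflection \<open>2\<^sup>a - m\<close> of the Dirichlet kernels into an exact complement.
\<close>

lemma fejer_sum_reflect:
  "m < 2 ^ a \<Longrightarrow> fejer_sum (2 ^ a - 1 - m) x
     = fejer_sum (2 ^ a) x - real (m + 1) * dirichlet (2 ^ a) x + walsh (2 ^ a - 1) x * fejer_sum m x"
proof (induction m)
  case 0
  show ?case using fejer_sum_Suc[of "2 ^ a - 1" x] by simp
next
  case (Suc m)
  then have "2 ^ a - 1 - m = Suc (2 ^ a - 1 - Suc m)" by simp
  then have "fejer_sum (2 ^ a - 1 - m) x
      = fejer_sum (2 ^ a - 1 - Suc m) x + dirichlet (2 ^ a - Suc m) x"
    by (simp only: fejer_sum_Suc) (use Suc.prems in simp)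
  with Suc dirichlet_reflect[of "Suc m" a x] show ?case
    by (simp add: fejer_sum_Suc algebra_simps)
qed

section \<open>The integral of the square root of the norm\<close>

text \<open>
  The square root of the \<open>L\<^bsub>1/2\<^esub>\<close> quasi-norm: unlike the quasi-norm it satisfies the triangle
  inequality, at the price of being homogeneous of degree 1/2.
\<close>

definition root_mass :: "(walsh_group \<Rightarrow> 'b::real_normed_vector) \<Rightarrow> real" where
  "root_mass f = (LINT x|haar. sqrt (norm (f x)))"

lemma sqrt_norm_add_le: "sqrt (norm (x + y)) \<le> sqrt (norm x) + sqrt (norm y)"
  by (meson norm_ge_zero norm_triangle_ineq order_trans real_sqrt_le_mono sqrt_add_le_add_sqrt)

lemma integrable_sqrt_cylinder: "cylinder N f \<Longrightarrow> integrable haar (\<lambda>x. sqrt (norm (f x)))"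
  by (rule integrable_cylinder[of N], rule cylinder_comp)

lemma root_mass_nonneg [simp]: "0 \<le> root_mass f"
  by (simp add: root_mass_def)

lemma root_mass_add:
  assumes "cylinder N f" "cylinder N g"
  shows "root_mass (\<lambda>x. f x + g x) \<le> root_mass f + root_mass g"
proof -
  have "cylinder N (\<lambda>x. f x + g x)"
    using assms by (rule cylinder_comp2)
  then have "root_mass (\<lambda>x. f x + g x) \<le> (LINT x|haar. sqrt (norm (f x)) + sqrt (norm (g x)))"
    unfolding root_mass_def
    by (intro integral_mono sqrt_norm_add_le integrable_sqrt_cylinder
        Bochner_Integration.integrable_add integrable_sqrt_cylinder[OF assms(1)]
        integrable_sqrt_cylinder[OF assms(2)])
  also have "\<dots> = root_mass f + root_mass g"
    unfolding root_mass_def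
    by (intro Bochner_Integration.integral_add integrable_sqrt_cylinder[OF assms(1)]
        integrable_sqrt_cylinder[OF assms(2)])
  finally show ?thesis .
qed

lemma root_mass_scaleR: "root_mass (\<lambda>x. c *\<^sub>R f x) = sqrt \<bar>c\<bar> * root_mass f"
  by (simp add: root_mass_def real_sqrt_mult)

lemma root_mass_mult: "root_mass (\<lambda>x. c * f x) = sqrt \<bar>c\<bar> * root_mass f" for c :: real
  by (simp add: root_mass_def real_sqrt_mult abs_mult)

lemma root_mass_unimodular: "(\<And>x. \<bar>u x\<bar> = 1) \<Longrightarrow> root_mass (\<lambda>x. u x *\<^sub>R f x) = root_mass f"
  by (simp add: root_mass_def)

lemma root_mass_dirichlet_pow2: "root_mass (\<lambda>x. c * dirichlet (2 ^ N) x) = sqrt (\<bar>c\<bar> * 2 ^ N) / 2 ^ N"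
proof -
  interpret prob_space haar by (rule prob_space_haar)
  have "sqrt (norm (c * dirichlet (2 ^ N) x))
      = sqrt (\<bar>c\<bar> * 2 ^ N) * indicator (dyadic_interval N (\<lambda>_. 0)) x" for x
    by (simp add: dirichlet_pow2 indicator_def abs_mult)
  then show ?thesis
    by (simp add: root_mass_def measure_dyadic_interval)
qed

text \<open>
  The recursion from \<open>2\<^sup>N\<close> to \<open>2\<^bsup>N+1\<^esup>\<close> multiplies the kernel by \<open>1 + r\<^sub>N\<close>, which is 2 on one half of
  the group and 0 on the other. This contracts the root mass by \<open>\<surd>2 / 2\<close>, and the Dirichlet kernel
  adds exactly 1; the bound 4 is invariant because \<open>2 \<surd>2 + 1 \<le> 4\<close>.
\<close>

lemma root_mass_fejer_sum_pow2: "root_mass (fejer_sum (2 ^ N)) \<le> 4"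
proof (induction N)
  case 0
  interpret prob_space haar by (rule prob_space_haar)
  have "fejer_sum (2 ^ 0) x = 1" for x
    using fejer_sum_Suc[of 0 x] by (simp add: dirichlet_def lessThan_Suc)
  then show ?case by (simp add: root_mass_def prob_space[simplified])
next
  case (Suc N)
  let ?T = "fejer_sum (2 ^ N)"
  have T: "cylinder N ?T" by (rule cylinder_fejer_sum) simp
  have T': "cylinder (Suc N) (\<lambda>x. (1 + rademacher N x) * ?T x)"
    by (intro cylinder_comp2[where h = "\<lambda>r t. (1 + r) * t"] cylinder_rademacher
        cylinder_mono[OF T]) auto
  have "root_mass (\<lambda>x. (1 + rademacher N x) * ?T x) = sqrt 2 / 2 * root_mass ?T"
    unfolding root_mass_def
    by (subst integral_cylinder_Suc[OF cylinder_comp[OF T']])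
       (simp add: cylinder_fun_upd[OF T] real_sqrt_mult abs_mult)
  also have "\<dots> \<le> sqrt 2 / 2 * 4"
    using Suc by (intro mult_left_mono) auto
  also have "\<dots> \<le> 3"
  proof -
    have "sqrt 2 \<le> 3 / 2" by (rule real_le_lsqrt) (auto simp: power2_eq_square)
    then show ?thesis by simp
  qed
  finally have "root_mass (\<lambda>x. (1 + rademacher N x) * ?T x) \<le> 3" .
  moreover have D: "root_mass (\<lambda>x. 2 ^ N * dirichlet (2 ^ N) x) = 1"
    by (simp add: root_mass_dirichlet_pow2)
  moreover have "cylinder (Suc N) (\<lambda>x. 2 ^ N * dirichlet (2 ^ N) x)"
    by (intro cylinder_comp[where h = "(*) (2 ^ N)"] cylinder_dirichlet) auto
  note root_mass_add[OF T' this]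
  moreover have "fejer_sum (2 ^ Suc N)
      = (\<lambda>x. (1 + rademacher N x) * ?T x + 2 ^ N * dirichlet (2 ^ N) x)"
    by (rule ext) (rule fejer_sum_pow2_Suc)
  ultimately show ?case by simp
qed

section \<open>The variation\<close>

text \<open>
  The variation without the lowest digit. Complementing all digits below some position preserves the
  jumps between neighbours, whereas it exchanges the two values of the lowest digit; so this is the
  quantity that decreases in the induction for the upper bound.
\<close>

definition transitions :: "nat \<Rightarrow> real" where
  "transitions n = (\<Sum>j. \<bar>real (binary_digit n (Suc j)) - real (binary_digit n j)\<bar>)"

definition rises :: "nat \<Rightarrow> nat set" where
  "rises n = {j. binary_digit n j = 0 \<and> binary_digit n (Suc j) = 1}"

lemma variation_transitions: "variation n = real (binary_digit n 0) + transitions n"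
  by (simp add: variation_def transitions_def)

lemma transitions_eq:
  assumes "n < 2 ^ M"
  shows "transitions n = (\<Sum>j<M. \<bar>real (binary_digit n (Suc j)) - real (binary_digit n j)\<bar>)"
  unfolding transitions_def
  by (rule suminf_finite) (auto simp: binary_digit_small[OF assms])

lemma transitions_nonneg: "0 \<le> transitions n"
proof -
  have "n < 2 ^ n" by simp
  from transitions_eq[OF this] show ?thesis by (simp add: sum_nonneg)
qed

lemma rises_subset: "n < 2 ^ M \<Longrightarrow> rises n \<subseteq> {..<M}"
  using binary_digit_small[of n M] by (auto simp: rises_def not_le[symmetric] le_SucI)

lemma finite_rises [simp]: "finite (rises n)"
  using rises_subset[of n n] finite_subset by fastforce

text \<open>
  The digit sequence runs from the lowest digit up and ends with zeros, so ups and downs balance, if a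
  digit 1 at position 0 is counted as one more up.
\<close>

lemma variation_rises: "variation n = 2 * (real (binary_digit n 0) + real (card (rises n)))"
proof -
  let ?d = "\<lambda>j. real (binary_digit n j)"
  have n: "n < 2 ^ n" by simp
  have abs: "\<bar>?d (Suc j) - ?d j\<bar> = 2 * of_bool (j \<in> rises n) - (?d (Suc j) - ?d j)" for j
    using binary_digit_le_1[of n j] binary_digit_le_1[of n "Suc j"] by (auto simp: rises_def)
  have "transitions n = 2 * (\<Sum>j<n. of_bool (j \<in> rises n)) - (\<Sum>j<n. ?d (Suc j) - ?d j)"
    by (simp add: transitions_eq[OF n] abs sum_subtractf sum_distrib_left)
  also have "(\<Sum>j<n. ?d (Suc j) - ?d j) = - ?d 0"
    by (subst sum_lessThan_telescope[of ?d]) (simp add: binary_digit_small[OF n])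
  also have "(\<Sum>j<n. of_bool (j \<in> rises n) :: real) = real (card (rises n))"
    using rises_subset[OF n] by (simp add: of_bool_def sum.If_cases Int_absorb1)
  finally show ?thesis by (simp add: variation_transitions)
qed

lemma variation_ge_1:
  assumes "0 < n"
  shows "1 \<le> variation n"
proof -
  obtain N m where n: "n = 2 ^ N + m" and m: "m < 2 ^ N" by (rule obtain_top_digit[OF assms])
  have "n < 2 ^ Suc N" using n m by simp
  show ?thesis
  proof (cases "binary_digit n 0 = 1")
    case True
    then show ?thesis by (simp add: variation_rises)
  next
    case False
    then have 0: "binary_digit n 0 = 0" using binary_digit_le_1 by blast
    have N: "binary_digit n N = 1" unfolding n by (rule binary_digit_add_top[OF m])
    have "rises n \<noteq> {}"
    proof
      assume r: "rises n = {}"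
      have "binary_digit n j = 0" for j
      proof (induction j)
        case (Suc j)
        moreover have "j \<notin> rises n" using r by simp
        ultimately show ?case using binary_digit_le_1[of n "Suc j"] by (auto simp: rises_def)
      qed (fact 0)
      with N show False by simp
    qed
    then have "1 \<le> card (rises n)" by (simp add: Suc_leI card_gt_0_iff)
    then show ?thesis by (simp add: variation_rises)
  qed
qed

text \<open>
  Below position \<open>a\<close> all jumps survive; at the top the jump from 1 to 0 is lost because the
  complement ends one block earlier.
\<close>

lemma transitions_complement:
  assumes "n = 2 ^ a + m" "m < 2 ^ a"
  shows "transitions n = transitions (2 ^ Suc a - 1 - n) + 1"
proof -
  let ?c = "2 ^ Suc a - 1 - n"
  have n: "n < 2 ^ Suc a" and c: "?c < 2 ^ a" "?c < 2 ^ Suc a" using assms by auto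
  have top: "binary_digit n a = 1" "binary_digit n (Suc a) = 0"
      "binary_digit ?c a = 0" "binary_digit ?c (Suc a) = 0"
    using assms binary_digit_add_top binary_digit_small[OF n] binary_digit_small[OF c(1)] by auto
  have "(\<Sum>j<a. \<bar>real (binary_digit ?c (Suc j)) - real (binary_digit ?c j)\<bar>)
      = (\<Sum>j<a. \<bar>real (binary_digit n (Suc j)) - real (binary_digit n j)\<bar>)"
  proof (rule sum.cong[OF refl])
    fix j assume "j \<in> {..<a}"
    then have "j < Suc a" "Suc j < Suc a" by auto
    then have "binary_digit ?c j = 1 - binary_digit n j"
        "binary_digit ?c (Suc j) = 1 - binary_digit n (Suc j)"
      using binary_digit_complement[OF n] by blast+
    then show "\<bar>real (binary_digit ?c (Suc j)) - real (binary_digit ?c j)\<bar>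
        = \<bar>real (binary_digit n (Suc j)) - real (binary_digit n j)\<bar>"
      using binary_digit_le_1[of n j] binary_digit_le_1[of n "Suc j"] by auto
  qed
  then show ?thesis
    by (simp only: transitions_eq[OF n] transitions_eq[OF c(2)] sum.lessThan_Suc top)
qed

text \<open>
  Removing the top digit can destroy only the up that leads to it.
\<close>

lemma rises_remove_top:
  assumes n: "n = 2 ^ N + m" "m < 2 ^ N"
  shows "rises m \<subseteq> rises n" "rises n \<subseteq> insert (N - 1) (rises m)"
proof -
  have dig: "binary_digit n j = binary_digit m j" if "j < N" for j
    using that n by (simp add: binary_digit_add_low)
  have "n < 2 ^ Suc N" using n by simp
  show "rises m \<subseteq> rises n"
  proof
    fix j assume j: "j \<in> rises m"
    then have "Suc j < N"
      using binary_digit_small[OF n(2), of "Suc j"] by (auto simp: rises_def not_le[symmetric])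
    with j show "j \<in> rises n" by (simp add: rises_def dig)
  qed
  show "rises n \<subseteq> insert (N - 1) (rises m)"
  proof
    fix j assume j: "j \<in> rises n"
    then have "Suc j \<le> N"
      using binary_digit_small[OF \<open>n < 2 ^ Suc N\<close>, of "Suc j"]
      by (auto simp: rises_def Suc_le_eq not_le[symmetric])
    with j show "j \<in> insert (N - 1) (rises m)"
      by (cases "Suc j = N") (auto simp: rises_def dig)
  qed
qed

lemma transitions_remove_top:
  assumes n: "n = 2 ^ N + m" "m < 2 ^ N"
  shows "transitions m \<le> variation n"
proof -
  have "binary_digit m 0 \<le> binary_digit n 0"
    using n binary_digit_add_low[of 0 N m] by (cases "N = 0") (auto simp: binary_digit_def)
  moreover have "card (rises m) \<le> card (rises n)"
    by (intro card_mono rises_remove_top(1)[OF n]) simp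
  ultimately have "variation m \<le> variation n" by (simp add: variation_rises)
  then show ?thesis by (simp add: variation_transitions)
qed

lemma rises_remove_top_card:
  assumes n: "n = 2 ^ N + m" "m < 2 ^ N"
  shows "variation n / 2 - 2 \<le> real (card (rises m))"
proof -
  have "card (rises n) \<le> card (insert (N - 1) (rises m))"
    by (intro card_mono rises_remove_top(2)[OF n]) simp
  also have "\<dots> \<le> Suc (card (rises m))" by (rule card_insert_le_m1) auto
  finally show ?thesis
    using binary_digit_le_1[of n 0] by (auto simp: variation_rises)
qed

section \<open>Two-sided bounds for the Fej\'er kernel\<close>

text \<open>
  Induction along the complement map: each step costs at most 4 for the kernel of a power of 2 and 1
  for the Dirichlet kernel, and consumes one jump.
\<close>

lemma root_mass_fejer_sum_le_transitions: "root_mass (fejer_sum n) \<le> 5 * transitions n"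
proof (induction n rule: less_induct)
  case (less n)
  show ?case
  proof (cases "n = 0")
    case True
    have "fejer_sum 0 = (\<lambda>x. 0)" by (simp add: fun_eq_iff)
    with True transitions_nonneg[of n] show ?thesis by (simp add: root_mass_def)
  next
    case False
    then obtain a m where n: "n = 2 ^ a + m" and m: "m < 2 ^ a"
      using obtain_top_digit by blast
    define b where "b = Suc a"
    define c where "c = 2 ^ b - 1 - n"
    have c: "c < 2 ^ b" "c < n" "n = 2 ^ b - 1 - c"
      using n m by (auto simp: c_def b_def)
    let ?A = "\<lambda>x. fejer_sum (2 ^ b) x"
    let ?B = "\<lambda>x. - real (c + 1) * dirichlet (2 ^ b) x"
    let ?C = "\<lambda>x. walsh (2 ^ b - 1) x * fejer_sum c x"
    have cyl: "cylinder b ?A" "cylinder b ?B" "cylinder b ?C"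
      using c(1) by (auto intro!: cylinder_fejer_sum cylinder_comp2[where h = "(*)"]
          cylinder_walsh cylinder_dirichlet)
    have "fejer_sum n = (\<lambda>x. ?A x + ?B x + ?C x)"
      by (rule ext, subst c(3), subst fejer_sum_reflect[OF c(1)]) (simp add: algebra_simps)
    then have "root_mass (fejer_sum n) \<le> root_mass ?A + root_mass ?B + root_mass ?C"
      using root_mass_add[OF cyl(1,2)] root_mass_add[OF cylinder_comp2[OF cyl(1,2), of "(+)"] cyl(3)]
      by simp
    also have "root_mass ?A \<le> 4" by (rule root_mass_fejer_sum_pow2)
    also have "root_mass ?B \<le> 1"
    proof -
      (* the height (c + 1) 2^b is at most 4^b, on an interval of length 2^-b *)
      have "real (c + 1) * 2 ^ b \<le> 2 ^ b * 2 ^ b"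
        using c(1) by (intro mult_right_mono) (auto simp: Suc_le_eq of_nat_Suc[symmetric] simp del: of_nat_Suc)
      then have "sqrt (real (c + 1) * 2 ^ b) \<le> 2 ^ b"
        by (intro real_le_lsqrt) (auto simp: power2_eq_square)
      then show ?thesis by (subst root_mass_dirichlet_pow2) (simp add: add.commute)
    qed
    also have "root_mass ?C = root_mass (fejer_sum c)"
      using root_mass_unimodular[of "walsh (2 ^ b - 1)" "fejer_sum c"] by (simp add: abs_walsh)
    also have "\<dots> \<le> 5 * transitions c" by (rule less.IH[OF c(2)])
    finally show ?thesis
      using transitions_complement[OF n m] by (simp add: c_def b_def)
  qed
qed

lemma fejer_sum_at_common_zeros:
  assumes "x \<in> dyadic_interval j (\<lambda>_. 0)" "n \<le> 2 ^ j"
  shows "2 * fejer_sum n x = real n * (real n + 1)"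
  using assms(2)
proof (induction n)
  case (Suc n)
  have "walsh k x = 1" if "k < 2 ^ j" for k
    unfolding walsh_finite[OF that]
    using assms(1) by (intro prod.neutral) (auto simp: dyadic_interval_def rademacher_def)
  then have "dirichlet (Suc n) x = real (Suc n)"
    using Suc.prems by (simp add: dirichlet_def)
  with Suc show ?case by (simp add: fejer_sum_Suc algebra_simps)
qed simp

definition double_one :: "nat \<Rightarrow> walsh_group" where
  "double_one j = (\<lambda>i. if i = j \<or> i = Suc j then 1 else 0)"

text \<open>
  With \<open>D\<close> and \<open>T\<close> the kernels \<open>dirichlet\<close> and \<open>fejer_sum\<close>: near \<open>double_one j\<close> the digits of \<open>n\<close> above \<open>j + 1\<close> change only the sign: \<open>D\<^bsub>2^N\<^esub>\<close> vanishes for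
  \<open>N > j\<close> because \<open>x\<^sub>j = 1\<close>, and \<open>T\<^bsub>2^N\<^esub>\<close> vanishes for \<open>N > j + 1\<close> because moreover
  \<open>x\<^bsub>j+1\<^esub> = 1\<close>, which annihilates the factor \<open>1 + r\<^bsub>j+1\<^esub>\<close> in its recursion. So let \<open>j + 1\<close> be
  the top digit, with remainder \<open>m\<close>. Then \<open>T\<^sub>n = T\<^bsub>2^(j+1)\<^esub> - T\<^sub>m = 4\<^sup>j - T\<^sub>m\<close>, and as the digit \<open>j\<close>
  is 0, \<open>m < 2\<^sup>j\<close> and \<open>T\<^sub>m = m (m + 1) / 2\<close> compensates at most half of it.
\<close>

lemma abs_fejer_sum_ge:
  assumes x: "x \<in> dyadic_interval (j + 2) (double_one j)"
  shows "j \<in> rises n \<Longrightarrow> (2 ^ j)\<^sup>2 / 2 \<le> \<bar>fejer_sum n x\<bar>"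
proof (induction n rule: less_induct)
  case (less n)
  have xv: "x i = 0" if "i < j" for i
    using x that by (auto simp: dyadic_interval_def double_one_def)
  have xj: "x j = 1" "x (Suc j) = 1"
    using x by (auto simp: dyadic_interval_def double_one_def)
  have r: "rademacher j x = -1" "rademacher (Suc j) x = -1"
    using xj by (auto simp: rademacher_def)
  have xI: "x \<in> dyadic_interval j (\<lambda>_. 0)" using xv by (simp add: dyadic_interval_def)
  have D: "dirichlet (2 ^ N) x = 0" if "j < N" for N
    using that xj by (auto simp: dirichlet_pow2 indicator_def dyadic_interval_def)
  have T1: "fejer_sum (2 ^ Suc j) x = (2 ^ j)\<^sup>2"
    using xI by (subst fejer_sum_pow2_Suc) (simp add: r dirichlet_pow2 power2_eq_square)
  have T2: "fejer_sum (2 ^ (j + 2 + k)) x = 0" for k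
  proof (induction k)
    case 0
    have "fejer_sum (2 ^ Suc (Suc j)) x = 0"
      by (subst fejer_sum_pow2_Suc) (simp add: r D del: power_Suc)
    then show ?case by simp
  next
    case (Suc k)
    have "fejer_sum (2 ^ Suc (j + 2 + k)) x = 0"
      by (subst fejer_sum_pow2_Suc, subst Suc.IH, subst D) auto
    then show ?case by simp
  qed
  have "n \<noteq> 0"
    by (rule notI) (use less.prems in \<open>simp add: rises_def binary_digit_def\<close>)
  then obtain N m where n: "n = 2 ^ N + m" and m: "m < 2 ^ N"
    using obtain_top_digit by blast
  have "n < 2 ^ Suc N" using n m by simp
  then have "Suc j \<le> N"
    using less.prems binary_digit_small[of n "Suc N" "Suc j"] by (auto simp: rises_def Suc_le_eq not_le[symmetric])
  have eq: "fejer_sum n x = fejer_sum (2 ^ N) x + rademacher N x * fejer_sum m x"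
    using fejer_sum_add[of m N x] m D[of N] \<open>Suc j \<le> N\<close> by (simp add: n)
  show ?case
  proof (cases "N = Suc j")
    case True
    have "binary_digit m j = 0"
      using less.prems binary_digit_add_low[of j N m] by (simp add: rises_def n True)
    moreover have "m div 2 ^ j < 2"
      using m by (simp add: True less_mult_imp_div_less)
    ultimately have "m div 2 ^ j = 0" by (simp add: binary_digit_def)
    then have "m < 2 ^ j" by (simp add: div_eq_0_iff)
    then have "2 * fejer_sum m x = real m * (real m + 1)"
      by (intro fejer_sum_at_common_zeros[OF xI]) simp
    also have "\<dots> \<le> 2 ^ j * 2 ^ j"
    proof (intro mult_mono)
      have "real (Suc m) \<le> real (2 ^ j)" using \<open>m < 2 ^ j\<close> by (intro of_nat_mono) simp
      then show "real m + 1 \<le> 2 ^ j" by simp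
      then show "real m \<le> 2 ^ j" by linarith
    qed auto
    finally have "2 * fejer_sum m x \<le> (2 ^ j)\<^sup>2" by (simp add: power2_eq_square)
    then show ?thesis
      unfolding eq True T1 r using abs_ge_self[of "(2 ^ j)\<^sup>2 - fejer_sum m x"] by simp
  next
    case False
    then have "N = j + 2 + (N - (j + 2))" using \<open>Suc j \<le> N\<close> by simp
    then obtain k where N: "N = j + 2 + k" by blast
    have "j \<in> rises m"
      using less.prems binary_digit_add_low[of j N m] binary_digit_add_low[of "Suc j" N m] N
      by (simp add: rises_def n)
    moreover have "m < n" by (simp add: n)
    ultimately have "(2 ^ j)\<^sup>2 / 2 \<le> \<bar>fejer_sum m x\<bar>" by (intro less.IH)
    then show ?thesis unfolding eq N T2 by (simp add: abs_mult)
  qed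
qed

text \<open>
  The intervals around the points \<open>double_one j\<close> are disjoint for different \<open>j\<close>, and each rise
  contributes at least \<open>(2/3) 2\<^sup>j\<close> (a rational lower bound of \<open>2\<^sup>j / \<surd>2\<close>) on a set of measure
  \<open>2\<^bsup>-j-2\<^esup>\<close>.
\<close>

lemma root_mass_fejer_sum_ge_rises: "real (card (rises n)) / 6 \<le> root_mass (fejer_sum n)"
proof -
  interpret prob_space haar by (rule prob_space_haar)
  let ?E = "\<lambda>j. dyadic_interval (j + 2) (double_one j)"
  let ?h = "\<lambda>x. \<Sum>j\<in>rises n. 2 / 3 * 2 ^ j * indicator (?E j) x :: real"
  have le: "?h x \<le> sqrt (norm (fejer_sum n x))" for x
  proof (cases "\<exists>j\<in>rises n. x \<in> ?E j")
    case True
    then obtain j where j: "j \<in> rises n" "x \<in> ?E j" by blast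
    have uniq: "i = j" if "x \<in> ?E i" for i
    proof (rule ccontr)
      assume "i \<noteq> j"
      moreover have "x k = 1" "\<And>l. l < k \<Longrightarrow> x l = 0" if "x \<in> ?E k" for k
        using that by (auto simp: dyadic_interval_def double_one_def)
      from this[OF that] this[OF j(2)] have "\<not> i < j" "\<not> j < i" by auto
      ultimately show False by simp
    qed
    have "?h x = (\<Sum>i\<in>rises n. if i = j then 2 / 3 * 2 ^ j else 0)"
    proof (rule sum.cong[OF refl])
      fix i
      show "2 / 3 * 2 ^ i * indicator (?E i) x = (if i = j then 2 / 3 * 2 ^ j else 0 :: real)"
      proof (cases "i = j")
        case True
        with j(2) show ?thesis by simp
      next
        case False
        with uniq have "x \<notin> ?E i" by blast
        with False show ?thesis by simp
      qed
    qed
    also have "\<dots> = 2 / 3 * 2 ^ j" using j by simp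
    also have "\<dots> \<le> sqrt (norm (fejer_sum n x))"
    proof (rule real_le_rsqrt)
      have "(2 / 3 * 2 ^ j)\<^sup>2 = 4 / 9 * ((2 ^ j)\<^sup>2 :: real)"
        by (simp add: power2_eq_square)
      also have "\<dots> \<le> (2 ^ j)\<^sup>2 / 2" by simp
      finally show "(2 / 3 * 2 ^ j)\<^sup>2 \<le> norm (fejer_sum n x)"
        using abs_fejer_sum_ge[OF j(2,1)] by simp
    qed
    finally show ?thesis .
  next
    case False
    then have "?h x = 0" by (intro sum.neutral) auto
    then show ?thesis by simp
  qed
  have int: "integrable haar (\<lambda>x. 2 / 3 * 2 ^ j * indicator (?E j) x :: real)" for j
    by (intro integrable_mult_right) (simp add: emeasure_eq_measure)
  have "real (card (rises n)) / 6 = (\<Sum>j\<in>rises n. LINT x|haar. 2 / 3 * 2 ^ j * indicator (?E j) x)"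
    by (simp add: measure_dyadic_interval power_add)
  also have "\<dots> = (LINT x|haar. ?h x)"
    by (intro Bochner_Integration.integral_sum[symmetric] int)
  also have "\<dots> \<le> root_mass (fejer_sum n)"
    unfolding root_mass_def
    by (intro integral_mono le Bochner_Integration.integrable_sum int
        integrable_sqrt_cylinder[of n] cylinder_fejer_sum) auto
  finally show ?thesis .
qed

section \<open>Dyadic martingales as Rademacher series\<close>

lemma sets_dyadic_algebra: "sets (dyadic_algebra N) = sigma_sets UNIV (range (dyadic_interval N))"
  and space_dyadic_algebra [simp]: "space (dyadic_algebra N) = UNIV"
  by (simp_all add: dyadic_algebra_def)

lemma cylinder_indicator_dyadic_algebra:
  assumes "A \<in> sets (dyadic_algebra N)"
  shows "cylinder N (indicator A :: walsh_group \<Rightarrow> real)"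
proof -
  have sat: "(x \<in> A) = (y \<in> A)" if "\<forall>j<N. x j = y j" for x y
    using assms[unfolded sets_dyadic_algebra] that
    by induction (auto simp: dyadic_interval_def)
  show ?thesis
    unfolding cylinder_def
  proof (intro allI impI)
    fix x y :: walsh_group
    assume "\<forall>j<N. x j = y j"
    from sat[OF this] show "indicator A x = (indicator A y :: real)" by (simp add: indicator_def)
  qed
qed

text \<open>
  The \<open>\<sigma>\<close>-algebra is generated by a finite partition, so measurability means being constant on its
  cells, at every point and not only almost everywhere.
\<close>

lemma measurable_dyadic_algebra_iff:
  fixes f :: "walsh_group \<Rightarrow> 'b::{banach, second_countable_topology}"
  shows "f \<in> borel_measurable (dyadic_algebra N) \<longleftrightarrow> cylinder N f"
proof
  assume f: "f \<in> borel_measurable (dyadic_algebra N)"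
  show "cylinder N f"
    unfolding cylinder_def
  proof (intro allI impI)
    fix x y :: walsh_group
    assume xy: "\<forall>j<N. x j = y j"
    have "f -` {f x} \<inter> space (dyadic_algebra N) \<in> sets (dyadic_algebra N)"
      by (rule measurable_sets[OF f]) simp
    from cylinderD[OF cylinder_indicator_dyadic_algebra[OF this], of x y] xy
    show "f x = f y" by (simp add: indicator_def split: if_splits)
  qed
next
  assume f: "cylinder N f"
  have "dyadic_interval N v \<in> sets (dyadic_algebra N)" for v
    by (auto simp: sets_dyadic_algebra)
  then have "(\<lambda>x. \<Sum>v\<in>cube N. indicator (dyadic_interval N v) x *\<^sub>R f v)
      \<in> borel_measurable (dyadic_algebra N)"
    by (intro borel_measurable_sum borel_measurable_scaleR borel_measurable_indicator) auto
  also have "(\<lambda>x. \<Sum>v\<in>cube N. indicator (dyadic_interval N v) x *\<^sub>R f v) = f"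
    by (intro ext) (rule cylinder_expansion[OF f, symmetric])
  finally show "f \<in> borel_measurable (dyadic_algebra N)" .
qed

lemma integral_dyadic_interval:
  fixes f :: "walsh_group \<Rightarrow> 'b::{banach, second_countable_topology}"
  assumes "cylinder N f"
  shows "(LINT v|haar. indicator (dyadic_interval N x) v *\<^sub>R f v) = (1 / 2 ^ N) *\<^sub>R f x"
proof -
  interpret prob_space haar by (rule prob_space_haar)
  have eq: "indicator (dyadic_interval N x) v *\<^sub>R f v = indicator (dyadic_interval N x) v *\<^sub>R f x" for v
  proof (cases "v \<in> dyadic_interval N x")
    case True
    then have "f v = f x" by (intro cylinderD[OF assms]) (simp add: dyadic_interval_def)
    then show ?thesis by simp
  qed simp
  show ?thesis
    unfolding eq by (simp add: measure_dyadic_interval emeasure_eq_measure)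
qed

text \<open>
  The form in which dyadic martingales are used below: the increments are explicit, and \<open>g N\<close> depends
  on fewer coordinates than the increment itself.
\<close>

locale rademacher_martingale =
  fixes F g :: "nat \<Rightarrow> walsh_group \<Rightarrow> 'b::{banach, second_countable_topology}"
  assumes cylinder_F: "cylinder N (F N)"
    and cylinder_g: "cylinder N (g N)"
    and F_Suc: "F (Suc N) x = F N x + rademacher N x *\<^sub>R g N x"
begin

lemma integral_mult_F:
  fixes h :: "walsh_group \<Rightarrow> real"
  assumes h: "cylinder n h" and "n \<le> m"
  shows "(LINT v|haar. h v *\<^sub>R F m v) = (LINT v|haar. h v *\<^sub>R F n v)"
  using \<open>n \<le> m\<close>
proof (induction m rule: dec_induct)
  case (step m)
  have hm: "cylinder m h" by (rule cylinder_mono[OF h step(1)])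
  have hF: "cylinder m (\<lambda>v. h v *\<^sub>R F m v)" and hg: "cylinder m (\<lambda>v. h v *\<^sub>R g m v)"
    by (rule cylinder_comp2[where h = scaleR, OF hm cylinder_F],
        rule cylinder_comp2[where h = scaleR, OF hm cylinder_g])
  have "cylinder (Suc m) (\<lambda>v. rademacher m v *\<^sub>R (h v *\<^sub>R g m v))"
    by (intro cylinder_comp2[where h = scaleR] cylinder_rademacher cylinder_mono[OF hg]) auto
  then have "(LINT v|haar. h v *\<^sub>R F m v + rademacher m v *\<^sub>R (h v *\<^sub>R g m v))
      = (LINT v|haar. h v *\<^sub>R F m v)"
    by (subst Bochner_Integration.integral_add[OF integrable_cylinder[OF hF] integrable_cylinder])
       (simp_all add: integral_rademacher_cylinder[OF hg] del: scaleR_scaleR)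
  also have "(\<lambda>v. h v *\<^sub>R F m v + rademacher m v *\<^sub>R (h v *\<^sub>R g m v)) = (\<lambda>v. h v *\<^sub>R F (Suc m) v)"
    by (simp add: F_Suc scaleR_add_right mult.commute)
  finally show ?case using step.IH by simp
qed simp

end

text \<open>
  On a cell of rank \<open>N\<close> the function \<open>F (N + 1)\<close> takes two values whose mean is \<open>F N\<close>; the increment
  therefore changes sign with the coordinate \<open>N\<close>.
\<close>

theorem dyadic_martingale_iff:
  "dyadic_martingale F \<longleftrightarrow> (\<exists>g. rademacher_martingale F g)"
proof
  assume F: "dyadic_martingale F"
  have cyl: "cylinder N (F N)" for N
    using F measurable_dyadic_algebra_iff unfolding dyadic_martingale_def is_cond_exp_def by blast
  define g where "g N v = F (Suc N) (v(N := 0)) - F N v" for N v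
  have cylb: "cylinder N (\<lambda>v. F (Suc N) (v(N := b)))" for N b
    using cyl[of "Suc N"] unfolding cylinder_def by auto
  have avg: "F N x = (1 / 2) *\<^sub>R (F (Suc N) (x(N := 0)) + F (Suc N) (x(N := 1)))" for N x
  proof -
    let ?A = "dyadic_interval N x"
    have A: "cylinder N (indicator ?A :: _ \<Rightarrow> real)" by (rule cylinder_dyadic_interval)
    have "?A \<in> sets (dyadic_algebra N)" by (auto simp: sets_dyadic_algebra)
    moreover have "is_cond_exp haar (dyadic_algebra N) (F (Suc N)) (F N)"
      using F unfolding dyadic_martingale_def by simp
    ultimately have "(LINT v|haar. indicator ?A v *\<^sub>R F (Suc N) v) = (LINT v|haar. indicator ?A v *\<^sub>R F N v)"
      unfolding is_cond_exp_def set_lebesgue_integral_def by blast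
    also have "(LINT v|haar. indicator ?A v *\<^sub>R F (Suc N) v)
        = (1 / 2 ^ N) *\<^sub>R ((1 / 2) *\<^sub>R (F (Suc N) (x(N := 0)) + F (Suc N) (x(N := 1))))"
      by (subst integral_cylinder_Suc[OF cylinder_comp2[where h = scaleR, OF cylinder_mono[OF A] cyl]])
         (simp_all add: cylinder_fun_upd[OF A] integral_dyadic_interval[OF cylb] scaleR_add_right mult.commute)
    finally show ?thesis
      by (simp add: integral_dyadic_interval[OF cyl] del: scaleR_scaleR)
  qed
  have "F (Suc N) x = F N x + rademacher N x *\<^sub>R g N x" for N x
  proof (cases "x N = 0")
    case True
    then have "x(N := 0) = x" by auto
    with True show ?thesis by (simp add: rademacher_def g_def)
  next
    case False
    then have "x(N := 1) = x" by (auto simp: fun_eq_iff)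
    with avg[of N x] have "F (Suc N) x = 2 *\<^sub>R F N x - F (Suc N) (x(N := 0))"
      by simp
    with False show ?thesis by (simp add: rademacher_def g_def scaleR_2)
  qed
  moreover have "cylinder N (g N)" for N
    unfolding g_def by (rule cylinder_comp2[OF cylb cyl])
  ultimately show "\<exists>g. rademacher_martingale F g"
    using cyl by (auto simp: rademacher_martingale_def)
next
  assume "\<exists>g. rademacher_martingale F g"
  then obtain g where "rademacher_martingale F g" by blast
  then interpret rademacher_martingale F g .
  show "dyadic_martingale F"
    unfolding dyadic_martingale_def is_cond_exp_def set_lebesgue_integral_def
  proof (intro allI impI conjI ballI)
    fix n m :: nat and A
    assume "n \<le> m"
    show "integrable haar (F m)" "integrable haar (F n)" by (rule integrable_cylinder[OF cylinder_F])+
    show "F n \<in> borel_measurable (dyadic_algebra n)"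
      by (simp add: measurable_dyadic_algebra_iff cylinder_F)
    assume "A \<in> sets (dyadic_algebra n)"
    from integral_mult_F[OF cylinder_indicator_dyadic_algebra[OF this] \<open>n \<le> m\<close>]
    show "(LINT x|haar. indicator A x *\<^sub>R F m x) = (LINT x|haar. indicator A x *\<^sub>R F n x)" .
  qed
qed

section \<open>Walsh convolution\<close>

text \<open>
  Characteristic 2 makes \<open>x \<oplus> v\<close> the difference as well as the sum.
\<close>

definition walsh_convolution ::
  "(walsh_group \<Rightarrow> real) \<Rightarrow> (walsh_group \<Rightarrow> 'b) \<Rightarrow> walsh_group \<Rightarrow> 'b::{banach, second_countable_topology}"
where
  "walsh_convolution K f x = (LINT v|haar. K (x \<oplus> v) *\<^sub>R f v)"

lemma cylinder_convolution: "cylinder N K \<Longrightarrow> cylinder N (walsh_convolution K f)"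
proof -
  assume K: "cylinder N K"
  show ?thesis
    unfolding cylinder_def
  proof (intro allI impI)
    fix x y :: walsh_group
    assume xy: "\<forall>j<N. x j = y j"
    have eq: "K (x \<oplus> v) = K (y \<oplus> v)" for v
    proof (rule cylinderD[OF K])
      fix j assume "j < N"
      with xy have "x j = y j" by blast
      then show "(x \<oplus> v) j = (y \<oplus> v) j"
        unfolding gplus_def by (rule arg_cong)
    qed
    show "walsh_convolution K f x = walsh_convolution K f y"
      by (simp only: walsh_convolution_def eq)
  qed
qed

lemma cylinder_convolution_integrand:
  "cylinder N K \<Longrightarrow> cylinder N f \<Longrightarrow> cylinder N (\<lambda>v. K (x \<oplus> v) *\<^sub>R f v)"
  by (rule cylinder_comp2[where h = scaleR, OF cylinder_translate[where f = K and x = x]])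

lemma walsh_convolution_dirichlet_pow2:
  assumes "cylinder N f"
  shows "walsh_convolution (dirichlet (2 ^ N)) f x = f x"
proof -
  have "x \<oplus> v \<in> dyadic_interval N (\<lambda>_. 0) \<longleftrightarrow> v \<in> dyadic_interval N x" for v
  proof -
    have "x j + v j = 0 \<longleftrightarrow> v j = x j" for j
      by (cases "x j"; cases "v j") simp_all
    then show ?thesis by (simp add: dyadic_interval_def gplus_def)
  qed
  then have eq: "dirichlet (2 ^ N) (x \<oplus> v) *\<^sub>R f v
      = 2 ^ N *\<^sub>R (indicator (dyadic_interval N x) v *\<^sub>R f v)" for v
    by (simp add: dirichlet_pow2 indicator_def)
  show ?thesis
    unfolding walsh_convolution_def eq
    by (subst integral_scaleR_right) (simp add: integral_dyadic_interval[OF assms])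
qed

lemma sqrt_norm_sum_le: "sqrt (norm (\<Sum>i\<in>A. f i)) \<le> (\<Sum>i\<in>A. sqrt (norm (f i)))"
proof (induction A rule: infinite_finite_induct)
  case (insert i A)
  then show ?case using sqrt_norm_add_le[of "f i" "sum f A"] by simp
qed auto

text \<open>
  The convolution is a sum of \<open>2\<^sup>N\<close> translates of \<open>K\<close> with coefficients \<open>2\<^bsup>-N\<^esup> f(v)\<close>. The root mass
  is subadditive and translation invariant, and the factor \<open>2\<^bsup>N/2\<^esup>\<close> arises because the square root of
  the weight \<open>2\<^bsup>-N\<^esup>\<close> appears where an integral would have the weight itself.
\<close>

lemma root_mass_convolution:
  assumes K: "cylinder N K" and f: "cylinder N f"
  shows "root_mass (walsh_convolution K f) \<le> sqrt (2 ^ N) * root_mass K * root_mass f"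
proof -
  have sK: "cylinder N (\<lambda>x. sqrt \<bar>K x\<bar>)" and sf: "cylinder N (\<lambda>x. sqrt (norm (f x)))"
    by (rule cylinder_comp[OF K], rule cylinder_comp[OF f])
  have sKv: "cylinder N (\<lambda>x. sqrt \<bar>K (x \<oplus> v)\<bar>)" for v
    using cylinder_translate[OF sK, of v] by (simp add: gplus_commute)
  have le: "sqrt (norm (walsh_convolution K f x))
      \<le> (\<Sum>v\<in>cube N. sqrt (1 / 2 ^ N) * sqrt (norm (f v)) * sqrt \<bar>K (x \<oplus> v)\<bar>)" for x
  proof -
    have "sqrt (norm (walsh_convolution K f x))
        = sqrt (1 / 2 ^ N) * sqrt (norm (\<Sum>v\<in>cube N. K (x \<oplus> v) *\<^sub>R f v))"
      unfolding walsh_convolution_def integral_cylinder[OF cylinder_convolution_integrand[OF K f]]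
      by (simp add: real_sqrt_mult real_sqrt_divide)
    also have "\<dots> \<le> sqrt (1 / 2 ^ N) * (\<Sum>v\<in>cube N. sqrt (norm (K (x \<oplus> v) *\<^sub>R f v)))"
      by (intro mult_left_mono sqrt_norm_sum_le) simp
    finally show ?thesis by (simp add: sum_distrib_left real_sqrt_mult mult_ac)
  qed
  have int: "integrable haar (\<lambda>x. sqrt (1 / 2 ^ N) * sqrt (norm (f v)) * sqrt \<bar>K (x \<oplus> v)\<bar>)" for v
    by (intro integrable_mult_right integrable_cylinder[OF sKv])
  have trans: "(LINT x|haar. sqrt \<bar>K (x \<oplus> v)\<bar>) = root_mass K" for v
    using integral_translate[OF sK, of v] by (simp add: gplus_commute root_mass_def)
  have "root_mass (walsh_convolution K f)
      \<le> (LINT x|haar. (\<Sum>v\<in>cube N. sqrt (1 / 2 ^ N) * sqrt (norm (f v)) * sqrt \<bar>K (x \<oplus> v)\<bar>))"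
    unfolding root_mass_def
    by (intro integral_mono le Bochner_Integration.integrable_sum int
        integrable_sqrt_cylinder[OF cylinder_convolution[OF K]])
  also have "\<dots> = (\<Sum>v\<in>cube N. (LINT x|haar. sqrt (1 / 2 ^ N) * sqrt (norm (f v)) * sqrt \<bar>K (x \<oplus> v)\<bar>))"
    by (intro Bochner_Integration.integral_sum int)
  also have "\<dots> = sqrt (1 / 2 ^ N) * root_mass K * (\<Sum>v\<in>cube N. sqrt (norm (f v)))"
    by (simp add: trans sum_distrib_left sum_distrib_right mult_ac)
  also have "(\<Sum>v\<in>cube N. sqrt (norm (f v))) = 2 ^ N * root_mass f"
    by (simp add: root_mass_def integral_cylinder[OF sf])
  also have "sqrt (1 / 2 ^ N) * root_mass K * (2 ^ N * root_mass f)
      = (sqrt (1 / 2 ^ N) * 2 ^ N) * root_mass K * root_mass f"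
    by (simp only: mult_ac)
  also have "sqrt (1 / 2 ^ N) * 2 ^ N = sqrt (2 ^ N)"
    by (simp add: real_sqrt_divide real_div_sqrt)
  finally show ?thesis .
qed

section \<open>Fej\'er sums of a martingale\<close>

lemma (in rademacher_martingale) fourier_coeff_eq:
  assumes "k < 2 ^ N"
  shows "fourier_coeff F k = (LINT v|haar. walsh k v *\<^sub>R F N v)"
proof -
  have "eventually (\<lambda>n. (LINT v|haar. walsh k v *\<^sub>R F n v) = (LINT v|haar. walsh k v *\<^sub>R F N v)) sequentially"
    using eventually_ge_at_top[of N]
    by eventually_elim (rule integral_mult_F[OF cylinder_walsh[OF assms]])
  then have "(\<lambda>n. LINT v|haar. walsh k v *\<^sub>R F n v) \<longlonglongrightarrow> (LINT v|haar. walsh k v *\<^sub>R F N v)"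
    by (rule tendsto_eventually)
  then show ?thesis unfolding fourier_coeff_def by (rule limI)
qed

lemma (in rademacher_martingale) partial_sum_eq:
  assumes "n \<le> 2 ^ N"
  shows "partial_sum n F x = walsh_convolution (dirichlet n) (F N) x"
proof -
  have int: "integrable haar (\<lambda>v. walsh k (x \<oplus> v) *\<^sub>R F N v)" if "k < n" for k
    using that assms
    by (intro integrable_cylinder[OF cylinder_convolution_integrand[OF cylinder_walsh cylinder_F]]) simp
  have "walsh_convolution (dirichlet n) (F N) x = (\<Sum>k<n. (LINT v|haar. walsh k (x \<oplus> v) *\<^sub>R F N v))"
    unfolding walsh_convolution_def dirichlet_def scaleR_sum_left
    by (intro Bochner_Integration.integral_sum int) simp
  also have "\<dots> = partial_sum n F x"
    unfolding partial_sum_def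
    using assms by (intro sum.cong) (auto simp: walsh_gplus fourier_coeff_eq[of _ N] simp flip: scaleR_scaleR)
  finally show ?thesis by simp
qed

lemma (in rademacher_martingale) fejer_mean_eq:
  assumes "n \<le> 2 ^ N" "0 < n"
  shows "real n *\<^sub>R fejer_mean n F x = walsh_convolution (fejer_sum n) (F N) x"
proof -
  have int: "integrable haar (\<lambda>v. dirichlet k (x \<oplus> v) *\<^sub>R F N v)" if "k \<le> n" for k
    using that assms
    by (intro integrable_cylinder[OF cylinder_convolution_integrand[OF cylinder_dirichlet cylinder_F]]) simp
  have "walsh_convolution (fejer_sum n) (F N) x = (\<Sum>k\<le>n. walsh_convolution (dirichlet k) (F N) x)"
    unfolding walsh_convolution_def fejer_sum_def scaleR_sum_left
    by (intro Bochner_Integration.integral_sum int) simp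
  also have "\<dots> = (\<Sum>k\<le>n. partial_sum k F x)"
    using assms by (intro sum.cong) (auto simp: partial_sum_eq[of _ N])
  also have "\<dots> = (\<Sum>k=1..n. partial_sum k F x)"
    by (rule sum.mono_neutral_right) (auto simp: partial_sum_def not_less_eq_eq)
  finally show ?thesis using assms by (simp add: fejer_mean_def)
qed

lemma scaleR_rademacher_expand:
  fixes f g :: "'b::real_vector"
  assumes "s * s = 1"
  shows "(a + b * d + r * s * c) *\<^sub>R (f + s *\<^sub>R g)
     = ((a *\<^sub>R f + b *\<^sub>R (d *\<^sub>R f)) + r *\<^sub>R (c *\<^sub>R g)) + s *\<^sub>R ((a + b * d) *\<^sub>R g + (r * c) *\<^sub>R f)"
proof -
  have "(r * s * c) * s = r * c" using assms by algebra
  then have e: "(r * s * c) *\<^sub>R (s *\<^sub>R g) = (r * c) *\<^sub>R g" unfolding scaleR_scaleR by simp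
  show ?thesis
    unfolding scaleR_add_left scaleR_add_right e by (simp add: ac_simps)
qed

text \<open>
  Both the kernel and the martingale have a part independent of the coordinate \<open>N\<close> and a multiple of
  \<open>r\<^sub>N\<close>. In the product, the terms linear in \<open>r\<^sub>N(v)\<close> integrate to 0; the square \<open>r\<^sub>N(v)\<^sup>2 = 1\<close> leaves
  \<open>r\<^sub>N(x)\<close> times the convolution with \<open>g N\<close>.
\<close>

lemma (in rademacher_martingale) walsh_convolution_fejer_sum_add:
  assumes m: "m \<le> 2 ^ N"
  shows "walsh_convolution (fejer_sum (2 ^ N + m)) (F (Suc N)) x
     = walsh_convolution (fejer_sum (2 ^ N)) (F N) x + real m *\<^sub>R F N x
       + rademacher N x *\<^sub>R walsh_convolution (fejer_sum m) (g N) x"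
proof -
  let ?r = "rademacher N"
  let ?A = "\<lambda>v. fejer_sum (2 ^ N) (x \<oplus> v)" and ?C = "\<lambda>v. fejer_sum m (x \<oplus> v)"
    and ?D = "\<lambda>v. dirichlet (2 ^ N) (x \<oplus> v)"
  have A: "cylinder N ?A" and C: "cylinder N ?C" and D: "cylinder N ?D"
    using m by (auto intro!: cylinder_translate cylinder_fejer_sum cylinder_dirichlet)
  have c: "cylinder N (\<lambda>v. ?A v *\<^sub>R F N v)" "cylinder N (\<lambda>v. ?D v *\<^sub>R F N v)"
      "cylinder N (\<lambda>v. ?C v *\<^sub>R g N v)"
    by (intro cylinder_comp2[where h = scaleR] A C D cylinder_F cylinder_g)+
  define P where "P v = (?A v *\<^sub>R F N v + real m *\<^sub>R (?D v *\<^sub>R F N v)) + ?r x *\<^sub>R (?C v *\<^sub>R g N v)" for v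
  define Q where "Q v = ((?A v + real m * ?D v) *\<^sub>R g N v) + (?r x *\<^sub>R ?C v) *\<^sub>R F N v" for v
  have "cylinder N P"
    unfolding P_def
    by (intro cylinder_comp2[where h = plus] cylinder_comp[where h = "scaleR _"] c)
  have Q: "cylinder N Q"
    unfolding Q_def
    by (intro cylinder_comp2[where h = plus] cylinder_comp2[where h = scaleR]
        cylinder_comp2[where h = "\<lambda>a b. a + real m * b"] cylinder_comp[where h = "scaleR _"]
        A C D cylinder_F cylinder_g)
  have rQ: "cylinder (Suc N) (\<lambda>v. ?r v *\<^sub>R Q v)"
    by (intro cylinder_comp2[where h = scaleR] cylinder_rademacher cylinder_mono[OF Q]) auto
  have "fejer_sum (2 ^ N + m) (x \<oplus> v) *\<^sub>R F (Suc N) v = P v + ?r v *\<^sub>R Q v" for v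
    unfolding fejer_sum_add[OF m] F_Suc P_def Q_def rademacher_gplus
    by (subst scaleR_rademacher_expand) simp_all
  then have "walsh_convolution (fejer_sum (2 ^ N + m)) (F (Suc N)) x = (LINT v|haar. P v + ?r v *\<^sub>R Q v)"
    by (simp add: walsh_convolution_def)
  also have "\<dots> = (LINT v|haar. P v)"
    by (subst Bochner_Integration.integral_add[OF integrable_cylinder[OF \<open>cylinder N P\<close>] integrable_cylinder[OF rQ]])
       (simp add: integral_rademacher_cylinder[OF Q])
  also have "\<dots> = (LINT v|haar. ?A v *\<^sub>R F N v) + real m *\<^sub>R (LINT v|haar. ?D v *\<^sub>R F N v)
      + ?r x *\<^sub>R (LINT v|haar. ?C v *\<^sub>R g N v)"
    unfolding P_def using c[THEN integrable_cylinder]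
    by (simp del: scaleR_scaleR)
  also have "(LINT v|haar. ?D v *\<^sub>R F N v) = F N x"
    using walsh_convolution_dirichlet_pow2[OF cylinder_F] by (simp add: walsh_convolution_def)
  finally show ?thesis by (simp add: walsh_convolution_def)
qed

text \<open>
  \<open>2\<^sup>N\<close> times the error of the Fej\'er mean of order \<open>2\<^sup>N\<close> against \<open>F N\<close>.
\<close>

definition (in rademacher_martingale) dyadic_error :: "nat \<Rightarrow> walsh_group \<Rightarrow> 'b" where
  "dyadic_error N x = walsh_convolution (fejer_sum (2 ^ N)) (F N) x - 2 ^ N *\<^sub>R F N x"

lemma (in rademacher_martingale) cylinder_dyadic_error: "cylinder N (dyadic_error N)"
proof -
  have "cylinder N (walsh_convolution (fejer_sum (2 ^ N)) (F N))"
    by (intro cylinder_convolution cylinder_fejer_sum) simp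
  from cylinder_comp2[OF this cylinder_F, of "\<lambda>a b. a - 2 ^ N *\<^sub>R b"]
  show ?thesis unfolding dyadic_error_def[abs_def] .
qed

lemma (in rademacher_martingale) fejer_mean_error:
  assumes n: "n = 2 ^ N + m" "m < 2 ^ N"
  shows "real n *\<^sub>R (fejer_mean n F x - L)
     = dyadic_error N x + rademacher N x *\<^sub>R walsh_convolution (fejer_sum m) (g N) x + real n *\<^sub>R (F N x - L)"
proof -
  have "real n *\<^sub>R fejer_mean n F x = walsh_convolution (fejer_sum (2 ^ N + m)) (F (Suc N)) x"
    using n by (subst fejer_mean_eq[where N = "Suc N"]) auto
  also have "\<dots> = walsh_convolution (fejer_sum (2 ^ N)) (F N) x + real m *\<^sub>R F N x
       + rademacher N x *\<^sub>R walsh_convolution (fejer_sum m) (g N) x"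
    using n(2) by (intro walsh_convolution_fejer_sum_add) simp
  finally show ?thesis
    unfolding dyadic_error_def scaleR_diff_right by (simp add: n(1) scaleR_add_left)
qed

lemma (in rademacher_martingale) dyadic_error_Suc:
  "dyadic_error (Suc N) x = dyadic_error N x
     + rademacher N x *\<^sub>R (walsh_convolution (fejer_sum (2 ^ N)) (g N) x + (- (2 ^ Suc N)) *\<^sub>R g N x)"
proof -
  have expand: "(C + t *\<^sub>R f + r *\<^sub>R c) - (2 * t) *\<^sub>R (f + r *\<^sub>R h) = (C - t *\<^sub>R f) + r *\<^sub>R (c + (- (2 * t)) *\<^sub>R h)"
    for C f c h :: 'b and t r :: real
    by (simp add: algebra_simps flip: scaleR_2)
  have "(2::nat) ^ Suc N = 2 ^ N + 2 ^ N" by simp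
  then have "walsh_convolution (fejer_sum (2 ^ Suc N)) (F (Suc N)) x
      = walsh_convolution (fejer_sum (2 ^ N)) (F N) x + 2 ^ N *\<^sub>R F N x
       + rademacher N x *\<^sub>R walsh_convolution (fejer_sum (2 ^ N)) (g N) x"
    using walsh_convolution_fejer_sum_add[of "2 ^ N" N x] by (simp add: mult_2)
  then show ?thesis
    unfolding dyadic_error_def F_Suc by (simp only: expand power_Suc)
qed

lemma contraction_tendsto_0:
  fixes z d :: "nat \<Rightarrow> real"
  assumes z: "\<And>N. 0 \<le> z N" "\<And>N. z (Suc N) \<le> q * z N + d N"
    and q: "0 \<le> q" "q < 1" and d: "d \<longlonglongrightarrow> 0"
  shows "z \<longlonglongrightarrow> 0"
proof (rule LIMSEQ_I)
  fix e :: real assume e: "0 < e"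
  (* c is chosen so that e / 2 is the fixed point of t \<mapsto> q t + c *)
  define c where "c = e * (1 - q) / 2"
  have "0 < c" using e q by (simp add: c_def)
  then obtain N where N: "\<And>n. n \<ge> N \<Longrightarrow> d n < c"
    using order_tendstoD(2)[OF d] by (auto simp: eventually_sequentially)
  have le: "z (N + k) \<le> q ^ k * z N + e / 2" for k
  proof (induction k)
    case (Suc k)
    have "z (N + Suc k) \<le> q * z (N + k) + c"
      using z(2)[of "N + k"] N[of "N + k"] by simp
    also have "\<dots> \<le> q * (q ^ k * z N + e / 2) + c"
      using Suc q by (intro add_right_mono mult_left_mono) auto
    also have "c = e / 2 - q * (e / 2)" by (simp add: c_def field_simps)
    finally show ?case by (simp add: algebra_simps)
  qed (use e in simp)
  have "(\<lambda>k. q ^ k * z N) \<longlonglongrightarrow> 0 * z N"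
    using q by (intro tendsto_mult LIMSEQ_realpow_zero) auto
  then have "\<forall>\<^sub>F k in sequentially. q ^ k * z N < e / 2"
    using e by (intro order_tendstoD(2)) auto
  then obtain M where M: "\<And>k. k \<ge> M \<Longrightarrow> q ^ k * z N < e / 2"
    by (auto simp: eventually_sequentially)
  show "\<exists>n0. \<forall>n\<ge>n0. norm (z n - 0) < e"
  proof (intro exI allI impI)
    fix n assume "N + M \<le> n"
    then have "M \<le> n - N" "N + (n - N) = n" by auto
    then show "norm (z n - 0) < e"
      using le[of "n - N"] M[of "n - N"] z(1)[of n] by simp
  qed
qed

text \<open>
  The error accumulates increments of root mass at most \<open>6 \<cdot> 2\<^bsup>N/2\<^esup> \<rho>(g\<^sub>N)\<close>, where \<open>\<rho>\<close> denotes the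
  root mass, while the normalisation grows by the factor \<open>\<surd>2 \<ge> 4/3\<close> in each step.
\<close>

lemma (in rademacher_martingale) root_mass_dyadic_error_tendsto_0:
  assumes g0: "(\<lambda>N. root_mass (g N)) \<longlonglongrightarrow> 0"
  shows "(\<lambda>N. root_mass (dyadic_error N) / sqrt (2 ^ N)) \<longlonglongrightarrow> 0"
proof (rule contraction_tendsto_0[where q = "3/4" and d = "\<lambda>N. 6 * root_mass (g N)"])
  fix N
  let ?c = "walsh_convolution (fejer_sum (2 ^ N)) (g N)" and ?s = "sqrt (2 ^ N) :: real"
  have s: "0 < ?s" "sqrt (2 ^ Suc N) = sqrt 2 * ?s" by (simp_all add: real_sqrt_mult)
  have cyl: "cylinder N ?c" "cylinder N (\<lambda>x. (- (2 ^ Suc N)) *\<^sub>R g N x)"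
    by (intro cylinder_convolution cylinder_fejer_sum cylinder_comp[where h = "scaleR _"] cylinder_g; simp)+
  let ?h = "\<lambda>x. ?c x + (- (2 ^ Suc N)) *\<^sub>R g N x"
  have h: "cylinder N ?h" by (rule cylinder_comp2[OF cyl])
  have rh: "cylinder (Suc N) (\<lambda>x. rademacher N x *\<^sub>R ?h x)"
    by (intro cylinder_comp2[where h = scaleR] cylinder_rademacher cylinder_mono[OF h]) auto
  have "root_mass (dyadic_error (Suc N)) \<le> root_mass (dyadic_error N) + root_mass ?h"
  proof -
    have "dyadic_error (Suc N) = (\<lambda>x. dyadic_error N x + rademacher N x *\<^sub>R ?h x)"
      by (rule ext) (rule dyadic_error_Suc)
    with root_mass_add[OF cylinder_mono[OF cylinder_dyadic_error] rh, of N]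
      root_mass_unimodular[of "rademacher N" ?h]
    show ?thesis by simp
  qed
  also have "root_mass ?h \<le> root_mass ?c + sqrt 2 * ?s * root_mass (g N)"
    using root_mass_add[OF cyl] by (simp only: root_mass_scaleR abs_minus_cancel power_abs s abs_numeral)
  also have "root_mass ?c \<le> ?s * 4 * root_mass (g N)"
  proof -
    have "root_mass ?c \<le> ?s * root_mass (fejer_sum (2 ^ N)) * root_mass (g N)"
      by (intro root_mass_convolution cylinder_fejer_sum cylinder_g) simp
    also have "\<dots> \<le> ?s * 4 * root_mass (g N)"
      by (intro mult_right_mono mult_left_mono root_mass_fejer_sum_pow2) auto
    finally show ?thesis .
  qed
  also have "sqrt 2 * ?s * root_mass (g N) \<le> 2 * ?s * root_mass (g N)"
    using sqrt2_less_2 by (intro mult_right_mono) auto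
  finally have e: "root_mass (dyadic_error (Suc N)) \<le> root_mass (dyadic_error N) + 6 * ?s * root_mass (g N)"
    by (simp add: mult_ac)
  have "4 / 3 \<le> sqrt 2" by (rule real_le_rsqrt) (simp add: power2_eq_square)
  let ?z = "root_mass (dyadic_error N) / ?s + 6 * root_mass (g N)"
  have "?z * ?s = root_mass (dyadic_error N) + 6 * ?s * root_mass (g N)"
    using s(1) by (simp add: distrib_right)
  then have "root_mass (dyadic_error (Suc N)) / sqrt (2 ^ Suc N) \<le> (?z * ?s) / (sqrt 2 * ?s)"
    unfolding s(2) using e s(1) by (intro divide_right_mono) simp_all
  also have "\<dots> = ?z / sqrt 2" using s(1) by simp
  also have "\<dots> \<le> ?z / (4 / 3)"
    using \<open>4 / 3 \<le> sqrt 2\<close> by (intro divide_left_mono) auto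
  also have "\<dots> = 3 / 4 * (root_mass (dyadic_error N) / ?s) + 9 / 2 * root_mass (g N)"
    by simp
  also have "\<dots> \<le> 3 / 4 * (root_mass (dyadic_error N) / ?s) + 6 * root_mass (g N)"
    by (intro add_left_mono mult_right_mono) auto
  finally show "root_mass (dyadic_error (Suc N)) / sqrt (2 ^ Suc N)
      \<le> 3 / 4 * (root_mass (dyadic_error N) / ?s) + 6 * root_mass (g N)" .
next
  show "(\<lambda>N. 6 * root_mass (g N)) \<longlonglongrightarrow> 0"
    using tendsto_mult_left[OF g0, of 6] by simp
qed simp_all

section \<open>Martingales whose tails are small in \<open>L\<^sub>1\<^sub>/\<^sub>2\<close>\<close>

definition root_integral :: "(walsh_group \<Rightarrow> 'b::real_normed_vector) \<Rightarrow> ennreal" where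
  "root_integral f = (\<integral>\<^sup>+ x. ennreal (sqrt (norm (f x))) \<partial>haar)"

text \<open>
  The square root of the maximal function that defines the modulus of continuity, so that its integral is
  the square root of the modulus (lemma \<open>Hp_modulus_half\<close>).
\<close>

definition tail_root ::
  "(nat \<Rightarrow> walsh_group \<Rightarrow> 'b::real_normed_vector) \<Rightarrow> nat \<Rightarrow> walsh_group \<Rightarrow> ennreal" where
  "tail_root F N x = ennreal_powr (maximal_function (\<lambda>m x. F m x - F (min m N) x) x) (1 / 2)"

lemma ennreal_powr_half: "0 \<le> r \<Longrightarrow> ennreal_powr (ennreal r) (1 / 2) = ennreal (sqrt r)"
  by (simp add: ennreal_powr_def powr_half_sqrt)

lemma ennreal_powr_2: "0 \<le> r \<Longrightarrow> ennreal_powr (ennreal r) 2 = ennreal (r\<^sup>2)"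
  by (simp add: ennreal_powr_def)

lemma ennreal_powr_SUP_half_le:
  assumes "\<And>m. ennreal (sqrt (norm (f m))) \<le> S"
  shows "ennreal_powr (SUP m. ennreal (norm (f m))) (1 / 2) \<le> S"
proof (cases S)
  case (real s)
  have "norm (f m) \<le> s\<^sup>2" for m
  proof -
    have "sqrt (norm (f m)) \<le> s" using assms[of m] real by simp
    then have "(sqrt (norm (f m)))\<^sup>2 \<le> s\<^sup>2" by (intro power_mono) auto
    then show ?thesis by simp
  qed
  then have "(SUP m. ennreal (norm (f m))) \<le> ennreal (s\<^sup>2)"
    by (intro SUP_least ennreal_leI)
  then have "ennreal_powr (SUP m. ennreal (norm (f m))) (1 / 2) \<le> ennreal_powr (ennreal (s\<^sup>2)) (1 / 2)"
    by (intro ennreal_powr_mono) simp_all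
  also have "\<dots> = S" using real by (simp add: ennreal_powr_half)
  finally show ?thesis .
qed simp

lemma Lp_norm_half: "Lp_norm (1 / 2) (\<lambda>x. ennreal (norm (f x))) = ennreal_powr (root_integral f) 2"
  by (simp add: Lp_norm_def root_integral_def ennreal_powr_half)

lemma Hp_modulus_half: "Hp_modulus (1 / 2) N F = ennreal_powr (\<integral>\<^sup>+ x. tail_root F N x \<partial>haar) 2"
  by (simp add: Hp_modulus_def Hp_norm_def Lp_norm_def tail_root_def)

lemma root_integral_cylinder:
  "cylinder N f \<Longrightarrow> root_integral f = ennreal (root_mass f)"
  unfolding root_integral_def root_mass_def
  by (intro nn_integral_eq_integral integrable_sqrt_cylinder) auto

lemma root_integral_add:
  fixes f g :: "walsh_group \<Rightarrow> 'b::{banach, second_countable_topology}"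
  assumes [measurable]: "f \<in> borel_measurable haar" "g \<in> borel_measurable haar"
  shows "root_integral (\<lambda>x. f x + g x) \<le> root_integral f + root_integral g"
proof -
  have "root_integral (\<lambda>x. f x + g x)
      \<le> (\<integral>\<^sup>+ x. ennreal (sqrt (norm (f x))) + ennreal (sqrt (norm (g x))) \<partial>haar)"
    unfolding root_integral_def
    by (intro nn_integral_mono) (simp add: sqrt_norm_add_le flip: ennreal_plus)
  also have "\<dots> = root_integral f + root_integral g"
    unfolding root_integral_def by (intro nn_integral_add) simp_all
  finally show ?thesis .
qed

context rademacher_martingale
begin

lemma measurable_F [measurable]: "F N \<in> borel_measurable haar"
  by (rule measurable_cylinder[OF cylinder_F])

lemma measurable_limit [measurable]: "limit_function F \<in> borel_measurable haar"
  unfolding limit_function_def[abs_def] by (rule borel_measurable_lim_metric) simp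

lemma measurable_tail_root [measurable]: "tail_root F N \<in> borel_measurable haar"
proof -
  have [measurable]: "maximal_function (\<lambda>m x. F m x - F (min m N) x) \<in> borel_measurable haar"
    unfolding maximal_function_def[abs_def] by measurable
  show ?thesis
    unfolding tail_root_def[abs_def] ennreal_powr_def by measurable
qed

lemma sqrt_increment_le_tail_root:
  assumes "N \<le> m"
  shows "ennreal (sqrt (norm (F m x - F N x))) \<le> tail_root F N x"
proof -
  have "ennreal (norm (F m x - F (min m N) x)) \<le> maximal_function (\<lambda>m x. F m x - F (min m N) x) x"
    unfolding maximal_function_def by (rule SUP_upper) simp
  from ennreal_powr_mono[OF _ this, of "1 / 2"] show ?thesis
    using assms by (simp add: tail_root_def min_absorb2 ennreal_powr_half)
qed

lemma norm_g: "norm (g i x) = norm (F (Suc i) x - F i x)"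
  by (simp add: F_Suc)

lemma root_mass_g_le:
  "ennreal (root_mass (g N)) \<le> (\<integral>\<^sup>+ x. tail_root F N x \<partial>haar)"
proof -
  have "ennreal (root_mass (g N)) = (\<integral>\<^sup>+ x. ennreal (sqrt (norm (F (Suc N) x - F N x))) \<partial>haar)"
    using root_integral_cylinder[OF cylinder_g, of N] by (simp add: root_integral_def norm_g)
  also have "\<dots> \<le> (\<integral>\<^sup>+ x. tail_root F N x \<partial>haar)"
    by (intro nn_integral_mono sqrt_increment_le_tail_root) simp
  finally show ?thesis .
qed

text \<open>
  The factor 2 comes from comparing both \<open>F (i + 1)\<close> and \<open>F i\<close> with \<open>F N\<close>. Thus a small tail at one
  level makes all later increments small.
\<close>

lemma root_mass_g_le_earlier:
  assumes "N \<le> i"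
  shows "ennreal (root_mass (g i)) \<le> 2 * (\<integral>\<^sup>+ x. tail_root F N x \<partial>haar)"
proof -
  have "ennreal (sqrt (norm (g i x))) \<le> 2 * tail_root F N x" for x
  proof -
    have "sqrt (norm (g i x)) \<le> sqrt (norm (F (Suc i) x - F N x)) + sqrt (norm (F i x - F N x))"
      using sqrt_norm_add_le[of "F (Suc i) x - F N x" "- (F i x - F N x)"]
      by (simp only: norm_minus_cancel) (simp add: norm_g)
    then have "ennreal (sqrt (norm (g i x)))
        \<le> ennreal (sqrt (norm (F (Suc i) x - F N x))) + ennreal (sqrt (norm (F i x - F N x)))"
      by (simp flip: ennreal_plus)
    also have "\<dots> \<le> tail_root F N x + tail_root F N x"
      using assms by (intro add_mono sqrt_increment_le_tail_root) auto
    finally show ?thesis by (simp add: mult_2)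
  qed
  then have "root_integral (g i) \<le> (\<integral>\<^sup>+ x. 2 * tail_root F N x \<partial>haar)"
    unfolding root_integral_def by (intro nn_integral_mono)
  also have "\<dots> = 2 * (\<integral>\<^sup>+ x. tail_root F N x \<partial>haar)" by (rule nn_integral_cmult) simp
  finally show ?thesis by (simp add: root_integral_cylinder[OF cylinder_g])
qed

lemma sqrt_limit_le_tail_root:
  assumes "convergent (\<lambda>m. F m x)"
  shows "ennreal (sqrt (norm (F N x - limit_function F x))) \<le> tail_root F N x"
proof (rule tendsto_upperbound)
  have "(\<lambda>m. F m x) \<longlonglongrightarrow> limit_function F x"
    using assms by (simp add: limit_function_def convergent_LIMSEQ_iff)
  then show "(\<lambda>m. ennreal (sqrt (norm (F m x - F N x)))) \<longlonglongrightarrow> ennreal (sqrt (norm (F N x - limit_function F x)))"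
    by (subst norm_minus_commute[of "F N x"]) (intro tendsto_intros)
  show "\<forall>\<^sub>F m in sequentially. ennreal (sqrt (norm (F m x - F N x))) \<le> tail_root F N x"
    using eventually_ge_at_top[of N] by eventually_elim (rule sqrt_increment_le_tail_root)
qed simp

end

text \<open>
  Both directions of the theorem are about martingales whose modulus of continuity gets arbitrarily
  small.
\<close>

locale small_tail_martingale = rademacher_martingale +
  assumes small_tail: "0 < e \<Longrightarrow> \<exists>N. (\<integral>\<^sup>+ x. tail_root F N x \<partial>haar) < ennreal e"
begin

lemma root_mass_g_tendsto_0: "(\<lambda>i. root_mass (g i)) \<longlonglongrightarrow> 0"
proof (rule LIMSEQ_I)
  fix e :: real assume "0 < e"
  then obtain N where N: "(\<integral>\<^sup>+ x. tail_root F N x \<partial>haar) < ennreal (e / 2)"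
    using small_tail[of "e / 2"] by auto
  show "\<exists>n0. \<forall>i\<ge>n0. norm (root_mass (g i) - 0) < e"
  proof (intro exI allI impI)
    fix i assume "N \<le> i"
    have "ennreal (root_mass (g i)) \<le> 2 * (\<integral>\<^sup>+ x. tail_root F N x \<partial>haar)"
      by (rule root_mass_g_le_earlier[OF \<open>N \<le> i\<close>])
    also have "\<dots> < 2 * ennreal (e / 2)"
      using N by (intro ennreal_mult_strict_left_mono) auto
    also have "\<dots> = ennreal e"
      using \<open>0 < e\<close> by (simp flip: ennreal_mult' ennreal_numeral)
    finally show "norm (root_mass (g i) - 0) < e"
      using \<open>0 < e\<close> by (simp add: ennreal_less_iff)
  qed
qed

text \<open>
  The infimum of the tails has integral 0, hence vanishes almost everywhere, and where it does the
  sequence is Cauchy.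
\<close>

lemma AE_convergent: "AE x in haar. convergent (\<lambda>m. F m x)"
proof -
  have "(\<integral>\<^sup>+ x. (INF N. tail_root F N x) \<partial>haar) \<le> (\<integral>\<^sup>+ x. tail_root F N x \<partial>haar)" for N
    by (intro nn_integral_mono INF_lower) simp
  then have "(\<integral>\<^sup>+ x. (INF N. tail_root F N x) \<partial>haar) < ennreal e" if "0 < e" for e
    using small_tail[OF that] by (blast intro: le_less_trans)
  then have "(\<integral>\<^sup>+ x. (INF N. tail_root F N x) \<partial>haar) = 0"
    by (metis ennreal_le_epsilon add_0 le_zero_eq less_imp_le)
  then have "AE x in haar. (INF N. tail_root F N x) = 0"
    by (subst (asm) nn_integral_0_iff_AE) auto
  then show ?thesis
  proof eventually_elim
    fix x assume 0: "(INF N. tail_root F N x) = 0"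
    have "Cauchy (\<lambda>m. F m x)"
    proof (rule metric_CauchyI)
      fix e :: real assume "0 < e"
      then have "(INF N. tail_root F N x) < ennreal (sqrt (e / 2))" by (simp add: 0)
      then obtain N where N: "tail_root F N x < ennreal (sqrt (e / 2))"
        by (auto simp: INF_less_iff)
      have near: "dist (F m x) (F N x) < e / 2" if "N \<le> m" for m
        using le_less_trans[OF sqrt_increment_le_tail_root[OF that] N]
        by (simp add: ennreal_less_iff dist_norm)
      show "\<exists>M. \<forall>m\<ge>M. \<forall>n\<ge>M. dist (F m x) (F n x) < e"
      proof (intro exI allI impI)
        fix m n assume "N \<le> m" "N \<le> n"
        then show "dist (F m x) (F n x) < e"
          using near dist_triangle_half_l by metis
      qed
    qed
    then show "convergent (\<lambda>m. F m x)" by (rule Cauchy_convergent)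
  qed
qed

lemma root_integral_limit_le:
  "root_integral (\<lambda>x. F N x - limit_function F x) \<le> (\<integral>\<^sup>+ x. tail_root F N x \<partial>haar)"
  unfolding root_integral_def
  using AE_convergent by (intro nn_integral_mono_AE) (auto elim!: eventually_mono intro: sqrt_limit_le_tail_root)

context
  fixes n N m :: nat
  assumes n: "n = 2 ^ N + m" "m < 2 ^ N"
begin

lemma real_n: "0 < real n" "2 ^ N \<le> real n"
proof -
  have "real n = 2 ^ N + real m" by (simp add: n(1))
  moreover have "(0::real) < 2 ^ N" by simp
  ultimately show "0 < real n" "2 ^ N \<le> real n" by linarith+
qed

text \<open>
  The lower digits of \<open>n\<close> enter the rest of the error only through the factor \<open>1 / n\<close>.
\<close>

definition "main_term x = (1 / real n) *\<^sub>R (rademacher N x *\<^sub>R walsh_convolution (fejer_sum m) (g N) x)"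

lemma fejer_error_split:
  "fejer_mean n F x - limit_function F x
     = main_term x + ((1 / real n) *\<^sub>R dyadic_error N x + (F N x - limit_function F x))"
proof -
  note real_n(1)
  then have "fejer_mean n F x - limit_function F x
      = (1 / real n) *\<^sub>R (real n *\<^sub>R (fejer_mean n F x - limit_function F x))"
    by simp
  also have "\<dots> = main_term x + ((1 / real n) *\<^sub>R dyadic_error N x + (F N x - limit_function F x))"
    unfolding fejer_mean_error[OF n] main_term_def scaleR_add_right using real_n(1) by (simp add: add_ac)
  finally show ?thesis .
qed

lemma cylinder_main_term: "cylinder (Suc N) main_term"
proof -
  have "cylinder N (walsh_convolution (fejer_sum m) (g N))"
    using n by (intro cylinder_convolution cylinder_fejer_sum) simp
  from cylinder_comp2[OF cylinder_rademacher[of N "Suc N"] cylinder_mono[OF this],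
      of "\<lambda>r c. (1 / real n) *\<^sub>R (r *\<^sub>R c)"]
  show ?thesis unfolding main_term_def[abs_def] by simp
qed

lemma root_mass_main_term:
  "root_mass main_term = root_mass (walsh_convolution (fejer_sum m) (g N)) / sqrt (real n)"
  unfolding main_term_def root_mass_scaleR
  by (subst root_mass_unimodular) (simp_all add: real_sqrt_divide)

lemma root_integral_remainder_le:
  "root_integral (\<lambda>x. (1 / real n) *\<^sub>R dyadic_error N x + (F N x - limit_function F x))
     \<le> ennreal (root_mass (dyadic_error N) / sqrt (2 ^ N)) + (\<integral>\<^sup>+ x. tail_root F N x \<partial>haar)"
proof -
  have c: "cylinder N (\<lambda>x. (1 / real n) *\<^sub>R dyadic_error N x)"
    by (rule cylinder_comp[OF cylinder_dyadic_error])
  have "root_integral (\<lambda>x. (1 / real n) *\<^sub>R dyadic_error N x + (F N x - limit_function F x))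
      \<le> root_integral (\<lambda>x. (1 / real n) *\<^sub>R dyadic_error N x) + root_integral (\<lambda>x. F N x - limit_function F x)"
    by (intro root_integral_add measurable_cylinder[OF c]) simp
  also have "root_integral (\<lambda>x. (1 / real n) *\<^sub>R dyadic_error N x)
      = ennreal (root_mass (dyadic_error N) / sqrt (real n))"
    by (simp add: root_integral_cylinder[OF c] root_mass_scaleR real_sqrt_divide)
  also have "root_mass (dyadic_error N) / sqrt (real n) \<le> root_mass (dyadic_error N) / sqrt (2 ^ N)"
    using real_n by (intro divide_left_mono mult_pos_pos) auto
  finally show ?thesis
    using root_integral_limit_le[of N] by (meson add_mono ennreal_leI order_refl order_trans)
qed

lemma measurable_remainder:
  "(\<lambda>x. (1 / real n) *\<^sub>R dyadic_error N x + (F N x - limit_function F x)) \<in> borel_measurable haar"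
proof -
  have [measurable]: "dyadic_error N \<in> borel_measurable haar"
    by (rule measurable_cylinder[OF cylinder_dyadic_error])
  show ?thesis by measurable
qed

lemma root_integral_fejer_error_le:
  "root_integral (\<lambda>x. fejer_mean n F x - limit_function F x)
     \<le> ennreal (5 * variation n * root_mass (g N))
       + (ennreal (root_mass (dyadic_error N) / sqrt (2 ^ N)) + (\<integral>\<^sup>+ x. tail_root F N x \<partial>haar))"
proof -
  have "root_mass (walsh_convolution (fejer_sum m) (g N))
      \<le> sqrt (2 ^ N) * root_mass (fejer_sum m) * root_mass (g N)"
    using n by (intro root_mass_convolution cylinder_fejer_sum cylinder_g) simp
  also have "\<dots> \<le> sqrt (2 ^ N) * (5 * variation n) * root_mass (g N)"
    using root_mass_fejer_sum_le_transitions[of m] transitions_remove_top[OF n]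
    by (intro mult_right_mono mult_left_mono) auto
  also have "\<dots> \<le> sqrt (real n) * (5 * variation n) * root_mass (g N)"
    using real_n transitions_nonneg[of n] by (intro mult_right_mono) (auto simp: variation_transitions)
  finally have "root_mass main_term \<le> 5 * variation n * root_mass (g N)"
    using real_n by (simp add: root_mass_main_term divide_le_eq mult_ac)
  then have "root_integral main_term \<le> ennreal (5 * variation n * root_mass (g N))"
    unfolding root_integral_cylinder[OF cylinder_main_term] by (rule ennreal_leI)
  then show ?thesis
    unfolding fejer_error_split
    by (intro order_trans[OF root_integral_add] add_mono root_integral_remainder_le
        measurable_cylinder[OF cylinder_main_term] measurable_remainder)
qed

text \<open>
  The splitting of the error read backwards: if the mean error is small, so is the main term.
\<close>

lemma root_mass_main_term_le:
  "ennreal (root_mass (walsh_convolution (fejer_sum m) (g N)) / sqrt (real n))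
     \<le> root_integral (\<lambda>x. fejer_mean n F x - limit_function F x)
       + (ennreal (root_mass (dyadic_error N) / sqrt (2 ^ N)) + (\<integral>\<^sup>+ x. tail_root F N x \<partial>haar))"
proof -
  let ?R = "\<lambda>x. (1 / real n) *\<^sub>R dyadic_error N x + (F N x - limit_function F x)"
  let ?E = "\<lambda>x. fejer_mean n F x - limit_function F x"
  have main: "main_term = (\<lambda>x. ?E x + - ?R x)"
    by (rule ext) (simp add: fejer_error_split)
  have [measurable]: "?R \<in> borel_measurable haar" by (rule measurable_remainder)
  have [measurable]: "main_term \<in> borel_measurable haar"
    by (rule measurable_cylinder[OF cylinder_main_term])
  have "?E \<in> borel_measurable haar" unfolding fejer_error_split by measurable
  then have "root_integral main_term \<le> root_integral ?E + root_integral (\<lambda>x. - ?R x)"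
    unfolding main by (intro root_integral_add borel_measurable_uminus measurable_remainder)
  also have "root_integral (\<lambda>x. - ?R x) = root_integral ?R"
    unfolding root_integral_def norm_minus_cancel ..
  also note root_integral_remainder_le
  finally show ?thesis
    by (simp add: root_integral_cylinder[OF cylinder_main_term] root_mass_main_term)
qed

end

end

section \<open>The order of an index\<close>

lemma binary_order_eq:
  assumes n: "n = 2 ^ N + m" "m < 2 ^ N"
  shows "binary_order n = N"
  unfolding binary_order_def
proof (rule Max_eqI)
  have "n < 2 ^ Suc N" using n by simp
  have le: "j \<le> N" if "binary_digit n j \<noteq> 0" for j
  proof (rule ccontr)
    assume "\<not> j \<le> N"
    then have "binary_digit n j = 0" by (intro binary_digit_small[OF \<open>n < 2 ^ Suc N\<close>]) simp
    with that show False by simp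
  qed
  then have "{j. binary_digit n j \<noteq> 0} \<subseteq> {..N}" by blast
  then show "finite {j. binary_digit n j \<noteq> 0}" by (rule finite_subset) simp
  show "j \<le> N" if "j \<in> {j. binary_digit n j \<noteq> 0}" for j
    using that le by blast
  show "N \<in> {j. binary_digit n j \<noteq> 0}"
    using binary_digit_add_top[OF n(2)] by (simp add: n(1))
qed

lemma obtain_binary_order:
  assumes "0 < n"
  obtains m where "n = 2 ^ binary_order n + m" "m < 2 ^ binary_order n"
  using obtain_top_digit[OF assms] binary_order_eq by metis

lemma filterlim_binary_order:
  fixes n :: "nat \<Rightarrow> nat"
  assumes "strict_mono n" "\<And>k. 0 < n k"
  shows "filterlim (\<lambda>k. binary_order (n k)) at_top sequentially"
  unfolding filterlim_at_top
proof
  fix Z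
  show "\<forall>\<^sub>F k in sequentially. Z \<le> binary_order (n k)"
    using eventually_ge_at_top[of "2 ^ Z"]
  proof eventually_elim
    fix k :: nat assume k: "2 ^ Z \<le> k"
    obtain m where m: "n k = 2 ^ binary_order (n k) + m" "m < 2 ^ binary_order (n k)"
      using obtain_binary_order assms(2) by blast
    have "2 ^ Z \<le> n k" using k strict_mono_imp_increasing[OF assms(1), of k] by linarith
    also have "n k < 2 ^ Suc (binary_order (n k))" using m by simp
    finally show "Z \<le> binary_order (n k)" by (simp add: power_less_imp_less_exp less_Suc_eq_le del: power_Suc)
  qed
qed

section \<open>Convergence\<close>

text \<open>
  With \<open>w\<close> the square root of the modulus, the hypothesis says that \<open>V(n\<^sub>k) w(|n\<^sub>k|)\<close> tends to 0. As
  \<open>V \<ge> 1\<close>, also \<open>w(|n\<^sub>k|)\<close> does, which supplies the small tails; the three terms of the error are then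
  bounded by \<open>5 V w\<close>, the normalised dyadic error and \<open>w\<close>.
\<close>

theorem fejer_means_converge:
  fixes n :: "nat \<Rightarrow> nat"
    and F :: "nat \<Rightarrow> walsh_group \<Rightarrow> 'b::{banach, second_countable_topology}"
  assumes n: "strict_mono n" "\<And>k. 0 < n k"
    and F: "F \<in> hardy_space (1 / 2)"
    and small: "(\<lambda>k. enn2real (Hp_modulus (1 / 2) (binary_order (n k)) F))
      \<in> o(\<lambda>k. 1 / (variation (n k))\<^sup>2)"
  shows "(\<lambda>k. Lp_norm (1 / 2) (\<lambda>x. ennreal (norm (fejer_mean (n k) F x - limit_function F x))))
    \<longlonglongrightarrow> 0"
proof -
  define N where "N k = binary_order (n k)" for k
  define V where "V k = variation (n k)" for k
  define w where "w i = enn2real (\<integral>\<^sup>+ x. tail_root F i x \<partial>haar)" for i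
  have V: "1 \<le> V k" for k unfolding V_def by (rule variation_ge_1[OF n(2)])
  have w0: "0 \<le> w i" for i by (simp add: w_def)
  have "(\<integral>\<^sup>+ x. tail_root F i x \<partial>haar) < \<top>" for i
    using Hp_modulus_finite[OF _ F, of i] by (simp add: Hp_modulus_half ennreal_powr_less_top_iff)
  then have W: "(\<integral>\<^sup>+ x. tail_root F i x \<partial>haar) = ennreal (w i)" for i
    by (simp add: w_def less_top)
  have mod: "enn2real (Hp_modulus (1 / 2) i F) = (w i)\<^sup>2" for i
    using w0[of i] by (simp add: Hp_modulus_half W ennreal_powr_2)
  have Vw: "(\<lambda>k. V k * w (N k)) \<longlonglongrightarrow> 0"
  proof (rule LIMSEQ_I)
    fix e :: real assume "0 < e"
    then have "\<forall>\<^sub>F k in sequentially. norm ((w (N k))\<^sup>2) \<le> (e / 2)\<^sup>2 * norm (1 / (V k)\<^sup>2)"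
      using landau_o.smallD[OF small, of "(e / 2)\<^sup>2"] by (simp add: mod N_def V_def)
    then have "\<forall>\<^sub>F k in sequentially. norm (V k * w (N k) - 0) < e"
    proof eventually_elim
      fix k assume "norm ((w (N k))\<^sup>2) \<le> (e / 2)\<^sup>2 * norm (1 / (V k)\<^sup>2)"
      then have "(V k * w (N k))\<^sup>2 \<le> (e / 2)\<^sup>2"
        using V[of k] by (simp add: power_mult_distrib field_simps)
      then have "V k * w (N k) \<le> e / 2"
        by (rule power2_le_imp_le) (use \<open>0 < e\<close> in simp)
      then show "norm (V k * w (N k) - 0) < e"
        using V[of k] w0[of "N k"] \<open>0 < e\<close> by simp
    qed
    then show "\<exists>k0. \<forall>k\<ge>k0. norm (V k * w (N k) - 0) < e"
      by (simp add: eventually_sequentially)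
  qed
  have w_le: "w (N k) \<le> V k * w (N k)" for k
    using mult_right_mono[OF V[of k] w0[of "N k"]] by simp
  have w: "(\<lambda>k. w (N k)) \<longlonglongrightarrow> 0"
    by (rule tendsto_sandwich[OF _ _ tendsto_const Vw]) (simp_all add: w0 w_le)
  obtain g where "rademacher_martingale F g"
    using F by (auto simp: hardy_space_def dyadic_martingale_iff)
  then interpret rademacher_martingale F g .
  interpret small_tail_martingale F g
  proof
    fix e :: real assume "0 < e"
    then obtain k where "w (N k) < e"
      using order_tendstoD(2)[OF w] by (metis eventually_happens' sequentially_bot)
    then show "\<exists>i. (\<integral>\<^sup>+ x. tail_root F i x \<partial>haar) < ennreal e"
      using w0 by (auto simp: W ennreal_less_iff)
  qed
  define z where "z i = root_mass (dyadic_error i) / sqrt (2 ^ i)" for i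
  have z0: "0 \<le> z i" for i by (simp add: z_def)
  have z: "(\<lambda>k. z (N k)) \<longlonglongrightarrow> 0"
    unfolding z_def N_def
    by (rule filterlim_compose[OF root_mass_dyadic_error_tendsto_0[OF root_mass_g_tendsto_0]
          filterlim_binary_order[OF n]])
  define b where "b k = 5 * (V k * w (N k)) + (z (N k) + w (N k))" for k
  have b0: "0 \<le> b k" for k
    using w0[of "N k"] V[of k] z0[of "N k"] by (simp add: b_def)
  have le: "root_integral (\<lambda>x. fejer_mean (n k) F x - limit_function F x) \<le> ennreal (b k)" for k
  proof -
    obtain m where m: "n k = 2 ^ N k + m" "m < 2 ^ N k"
      unfolding N_def using obtain_binary_order n(2) by blast
    have "root_mass (g (N k)) \<le> w (N k)"
      using root_mass_g_le[of "N k"] w0 by (simp add: W)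
    then have "5 * V k * root_mass (g (N k)) \<le> 5 * (V k * w (N k))"
      using V[of k] by simp
    then have "ennreal (5 * V k * root_mass (g (N k))) + (ennreal (z (N k)) + ennreal (w (N k)))
        \<le> ennreal (5 * (V k * w (N k))) + (ennreal (z (N k)) + ennreal (w (N k)))"
      by (intro add_right_mono ennreal_leI)
    also have "\<dots> = ennreal (b k)"
      using w0[of "N k"] V[of k] z0[of "N k"] by (simp add: b_def)
    finally show ?thesis
      using root_integral_fejer_error_le[OF m] by (simp add: W V_def z_def)
  qed
  have "(\<lambda>k. (b k)\<^sup>2) \<longlonglongrightarrow> (5 * 0 + (0 + 0))\<^sup>2"
    unfolding b_def by (intro tendsto_intros Vw z w)
  then have lim: "(\<lambda>k. ennreal ((b k)\<^sup>2)) \<longlonglongrightarrow> 0"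
    by (auto intro!: tendsto_ennrealI simp flip: ennreal_0)
  have Lp_le: "Lp_norm (1 / 2) (\<lambda>x. ennreal (norm (fejer_mean (n k) F x - limit_function F x)))
      \<le> ennreal ((b k)\<^sup>2)" for k
    unfolding Lp_norm_half ennreal_powr_2[OF b0, symmetric]
    by (intro ennreal_powr_mono le) simp
  show ?thesis
    by (rule tendsto_sandwich[OF _ _ tendsto_const lim]) (simp_all add: Lp_le)
qed

section \<open>Divergence\<close>

text \<open>
  \<open>A i\<close> are the levels carrying a jump and \<open>1 / v i\<close> is the root mass of the jump there; \<open>v i\<close> will be
  the variation of the chosen indices.
\<close>

locale lacunary_weights =
  fixes A :: "nat \<Rightarrow> nat" and v :: "nat \<Rightarrow> real"
  assumes A: "strict_mono A"
    and v_pos: "0 < v i"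
    and v_double: "2 * v i \<le> v (Suc i)"
begin

definition weight :: "nat \<Rightarrow> real" where
  "weight j = (if j \<in> range A then 1 / v (inv A j) else 0)"

lemma weight_A [simp]: "weight (A i) = 1 / v i"
  using strict_mono_imp_inj_on[OF A] by (simp add: weight_def)

lemma weight_nonneg [simp]: "0 \<le> weight j"
  using v_pos by (simp add: weight_def less_imp_le)

lemma weight_outside: "j \<notin> range A \<Longrightarrow> weight j = 0"
  by (simp add: weight_def)

text \<open>
  A multiple of the indicator of the interval \<open>I\<^sub>j(0)\<close>: concentrated functions make the estimate for
  convolutions sharp. The factor \<open>4\<^sup>j\<close> normalises the root mass to \<open>weight j\<close>.
\<close>

definition jump :: "nat \<Rightarrow> walsh_group \<Rightarrow> 'b::{real_normed_field, banach, second_countable_topology}" where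
  "jump j x = of_real ((weight j)\<^sup>2 * 4 ^ j * indicator (dyadic_interval j (\<lambda>_. 0)) x)"

definition lacunary :: "nat \<Rightarrow> walsh_group \<Rightarrow> 'b::{real_normed_field, banach, second_countable_topology}" where
  "lacunary m x = (\<Sum>j<m. rademacher j x *\<^sub>R jump j x)"

lemma cylinder_jump: "cylinder j (jump j)"
  unfolding jump_def[abs_def]
  by (rule cylinder_comp[where h = "\<lambda>t. of_real ((weight j)\<^sup>2 * 4 ^ j * t)", OF cylinder_dyadic_interval])

sublocale rademacher_martingale lacunary jump
proof
  fix N x
  show "cylinder N (jump N)" by (rule cylinder_jump)
  show "lacunary (Suc N) x = lacunary N x + rademacher N x *\<^sub>R jump N x"
    by (simp add: lacunary_def)
  show "cylinder N (lacunary N)"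
    unfolding lacunary_def[abs_def]
    by (intro cylinder_sum cylinder_comp2[where h = scaleR] cylinder_rademacher
        cylinder_mono[OF cylinder_jump]) auto
qed

lemma sqrt_norm_jump:
  "sqrt (norm (jump j x)) = weight j * 2 ^ j * indicator (dyadic_interval j (\<lambda>_. 0)) x"
proof -
  have "(4::real) ^ j = (2 ^ j)\<^sup>2"
    by (simp add: power2_eq_square flip: power_mult_distrib)
  then have "sqrt ((weight j)\<^sup>2 * 4 ^ j) = weight j * 2 ^ j"
    by (simp add: real_sqrt_mult)
  then show ?thesis
    unfolding jump_def norm_of_real by (simp add: indicator_def)
qed

lemma tail_root_lacunary_le:
  "tail_root (lacunary :: nat \<Rightarrow> walsh_group \<Rightarrow> 'b::{real_normed_field, banach, second_countable_topology}) N x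
     \<le> (\<Sum>j. if N \<le> j then ennreal (weight j * 2 ^ j) * indicator (dyadic_interval j (\<lambda>_. 0)) x else 0)"
    (is "_ \<le> suminf ?s")
  unfolding tail_root_def maximal_function_def
proof (rule ennreal_powr_SUP_half_le)
  fix m
  let ?f = "lacunary :: nat \<Rightarrow> walsh_group \<Rightarrow> 'b"
  have "?f m x - ?f (min m N) x = (\<Sum>j=min m N..<m. rademacher j x *\<^sub>R jump j x)"
    unfolding lacunary_def by (subst sum_diff_nat_ivl[of 0, simplified atLeast0LessThan, symmetric]) simp_all
  then have "sqrt (norm (?f m x - ?f (min m N) x)) \<le> (\<Sum>j=min m N..<m. sqrt (norm (jump j x :: 'b)))"
    using sqrt_norm_sum_le[of "\<lambda>j. rademacher j x *\<^sub>R (jump j x :: 'b)" "{min m N..<m}"] by simp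
  then have "ennreal (sqrt (norm (?f m x - ?f (min m N) x)))
      \<le> (\<Sum>j=min m N..<m. ennreal (sqrt (norm (jump j x :: 'b))))"
    by (subst sum_ennreal) (auto intro: ennreal_leI)
  also have "\<dots> \<le> (\<Sum>j=min m N..<m. ?s j)"
    by (intro sum_mono) (auto simp: sqrt_norm_jump ennreal_mult ennreal_indicator min_def split: if_splits)
  also have "\<dots> \<le> suminf ?s"
    by (rule sum_le_suminf) auto
  finally show "ennreal (sqrt (norm (?f m x - ?f (min m N) x))) \<le> suminf ?s" .
qed

text \<open>
  The root masses of the jumps from level \<open>N\<close> on form a series dominated by a geometric one with first
  term at most \<open>1 / c\<close>.
\<close>

lemma tail_lacunary_le:
  assumes c: "0 < c" "\<And>i. N \<le> A i \<Longrightarrow> c \<le> v i"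
  shows "(\<integral>\<^sup>+ x. tail_root (lacunary :: nat \<Rightarrow> walsh_group \<Rightarrow> 'b::{real_normed_field, banach, second_countable_topology}) N x \<partial>haar)
    \<le> ennreal (2 / c)"
proof -
  define f where "f j = (if N \<le> j then ennreal (weight j) else 0)" for j
  (* a potential whose decrements dominate the terms, because 2 / v (i + 1) \<le> 1 / v i *)
  define T where "T i = (if N \<le> A i then 2 / v i else 2 / c)" for i
  have "(\<integral>\<^sup>+ x. tail_root (lacunary :: nat \<Rightarrow> walsh_group \<Rightarrow> 'b) N x \<partial>haar)
      \<le> (\<integral>\<^sup>+ x. (\<Sum>j. if N \<le> j then ennreal (weight j * 2 ^ j) * indicator (dyadic_interval j (\<lambda>_. 0)) x else 0) \<partial>haar)"
    by (intro nn_integral_mono tail_root_lacunary_le)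
  also have "\<dots> = (\<Sum>j. \<integral>\<^sup>+ x. (if N \<le> j then ennreal (weight j * 2 ^ j) * indicator (dyadic_interval j (\<lambda>_. 0)) x else 0) \<partial>haar)"
    by (rule nn_integral_suminf) measurable
  also have "\<dots> = suminf f"
    by (intro arg_cong[where f = suminf] ext)
       (simp add: f_def nn_integral_cmult_indicator emeasure_dyadic_interval flip: ennreal_mult)
  also have "\<dots> = (\<Sum>i. f (A i))"
    by (rule suminf_mono_reindex[OF A, symmetric]) (simp add: f_def weight_outside)
  also have "\<dots> \<le> ennreal (2 / c)"
  proof (rule suminf_le_const)
    fix M
    have step: "(if N \<le> A i then 1 / v i else 0) \<le> T i - T (Suc i)" for i
    proof (cases "N \<le> A i")
      case True
      moreover have "A i < A (Suc i)" using A by (simp add: strict_mono_Suc_iff)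
      moreover have "2 / v (Suc i) \<le> 1 / v i"
        using v_pos[of i] v_pos[of "Suc i"] v_double[of i] by (simp add: field_simps)
      ultimately show ?thesis by (simp add: T_def)
    next
      case False
      then show ?thesis
        using c(1) c(2)[of "Suc i"] by (auto simp: T_def intro!: divide_left_mono)
    qed
    have "f (A i) = ennreal (if N \<le> A i then 1 / v i else 0)" for i
      by (simp add: f_def)
    moreover have "0 \<le> (if N \<le> A i then 1 / v i else 0)" for i
      using v_pos[of i] by simp
    ultimately have "(\<Sum>i<M. f (A i)) = ennreal (\<Sum>i<M. if N \<le> A i then 1 / v i else 0)"
      by (simp only: sum_ennreal)
    also have "\<dots> \<le> ennreal (2 / c)"
    proof (rule ennreal_leI)
      have "(\<Sum>i<M. if N \<le> A i then 1 / v i else 0) \<le> (\<Sum>i<M. T i - T (Suc i))"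
        by (intro sum_mono step)
      also have "\<dots> = T 0 - T M" by (rule sum_lessThan_telescope')
      also have "\<dots> \<le> 2 / c"
      proof -
        have "0 \<le> T M" using c(1) v_pos[of M] by (simp add: T_def less_imp_le)
        moreover have "T 0 \<le> 2 / c"
          using c v_pos[of 0] by (auto simp: T_def intro!: divide_left_mono)
        ultimately show ?thesis by simp
      qed
      finally show "(\<Sum>i<M. if N \<le> A i then 1 / v i else 0) \<le> 2 / c" .
    qed
    finally show "(\<Sum>i<M. f (A i)) \<le> ennreal (2 / c)" .
  qed simp
  finally show ?thesis .
qed

lemma v_ge_pow2: "v 0 * 2 ^ i \<le> v i"
proof (induction i)
  case (Suc i)
  then show ?case using v_double[of i] by simp
qed simp

lemma v_mono: "i \<le> j \<Longrightarrow> v i \<le> v j"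
  by (rule lift_Suc_mono_le[of v])
     (use v_double v_pos in \<open>smt (verit)\<close>)+

lemma tail_lacunary_at_A_le:
  "(\<integral>\<^sup>+ x. tail_root (lacunary :: nat \<Rightarrow> walsh_group \<Rightarrow> 'b::{real_normed_field, banach, second_countable_topology}) (A i) x \<partial>haar)
    \<le> ennreal (2 / v i)"
  using A by (intro tail_lacunary_le v_pos v_mono) (simp add: strict_mono_less_eq)

lemma inverse_v_tendsto_0: "(\<lambda>i. 2 / v i) \<longlonglongrightarrow> 0"
proof (rule tendsto_sandwich[OF _ _ tendsto_const])
  have "(\<lambda>i. (2 / v 0) * (1 / 2) ^ i) \<longlonglongrightarrow> (2 / v 0) * 0"
    by (intro tendsto_intros LIMSEQ_realpow_zero) auto
  then show "(\<lambda>i. (2 / v 0) * (1 / 2) ^ i) \<longlonglongrightarrow> 0" by simp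
  have "2 / v i \<le> 2 / (v 0 * 2 ^ i)" for i
    using v_ge_pow2[of i] v_pos[of i] v_pos[of 0] by (intro divide_left_mono) auto
  then show "\<forall>\<^sub>F i in sequentially. 2 / v i \<le> (2 / v 0) * (1 / 2) ^ i"
    by (simp add: power_one_over)
  show "\<forall>\<^sub>F i in sequentially. 0 \<le> 2 / v i"
    using v_pos by (simp add: less_imp_le)
qed

sublocale small_tail_martingale lacunary jump
proof
  fix e :: real assume "0 < e"
  then obtain i where "2 / v i < e"
    using order_tendstoD(2)[OF inverse_v_tendsto_0] by (metis eventually_happens' sequentially_bot)
  then show "\<exists>N. (\<integral>\<^sup>+ x. tail_root lacunary N x \<partial>haar) < ennreal e"
    using le_less_trans[OF tail_lacunary_at_A_le[of i]] v_pos[of i]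
    by (metis ennreal_less_iff divide_nonneg_pos zero_le_numeral)
qed

lemma lacunary_hardy:
  "(lacunary :: nat \<Rightarrow> walsh_group \<Rightarrow> 'b::{real_normed_field, banach, second_countable_topology})
     \<in> hardy_space (1 / 2)"
proof -
  let ?f = "lacunary :: nat \<Rightarrow> walsh_group \<Rightarrow> 'b"
  have eq: "(\<lambda>m x. ?f m x - ?f (min m 0) x) = ?f"
    by (simp add: lacunary_def fun_eq_iff)
  have "(\<integral>\<^sup>+ x. tail_root ?f 0 x \<partial>haar) \<le> ennreal (2 / v 0)"
    by (intro tail_lacunary_le v_pos v_mono) simp
  also have "\<dots> < \<top>" by simp
  finally have "Hp_modulus (1 / 2) 0 ?f < \<top>"
    unfolding Hp_modulus_half ennreal_powr_less_top_iff .
  then have "Hp_norm (1 / 2) ?f < \<top>" unfolding Hp_modulus_def eq .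
  moreover have "dyadic_martingale ?f"
    unfolding dyadic_martingale_iff using rademacher_martingale_axioms by blast
  ultimately show ?thesis
    by (simp add: hardy_space_def)
qed

lemma walsh_convolution_jump:
  assumes "cylinder N K"
  shows "walsh_convolution K (jump N) x = of_real ((weight N)\<^sup>2 * 2 ^ N * K x)"
proof -
  let ?h = "\<lambda>v. of_real ((weight N)\<^sup>2 * 4 ^ N * K (x \<oplus> v))"
  have h: "cylinder N ?h"
    by (rule cylinder_comp[OF cylinder_translate[OF assms], of "\<lambda>t. of_real ((weight N)\<^sup>2 * 4 ^ N * t)"])
  have eq: "K (x \<oplus> v) *\<^sub>R jump N v = indicator (dyadic_interval N (\<lambda>_. 0)) v *\<^sub>R ?h v" for v
    by (simp add: jump_def indicator_def scaleR_conv_of_real mult_ac)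
  have x0: "x \<oplus> (\<lambda>_. 0) = x" unfolding gplus_def by (rule ext) (rule add_0_right)
  have pow: "(4::real) ^ N = 2 ^ N * 2 ^ N" by (simp flip: power_mult_distrib)
  show ?thesis
    unfolding walsh_convolution_def eq integral_dyadic_interval[OF h] unfolding x0 pow
    by (simp add: scaleR_conv_of_real)
qed

text \<open>
  At a level that carries a jump the main term is the jump's amplitude times the kernel itself, so its
  root mass is comparable to \<open>V / v\<close>, that is to 1. The assumption \<open>8 \<le> v i\<close> absorbs the additive
  constant by which half the variation may exceed the number of rises.
\<close>

lemma fejer_error_lower_bound:
  assumes n: "n = 2 ^ A i + m" "m < 2 ^ A i" and v: "v i = variation n" "8 \<le> v i"
  shows "ennreal (1 / 36) \<le> root_integral (\<lambda>x. fejer_mean n lacunary x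
      - limit_function (lacunary :: nat \<Rightarrow> walsh_group \<Rightarrow> 'b::{real_normed_field, banach, second_countable_topology}) x)
    + (ennreal (root_mass (dyadic_error (A i) :: walsh_group \<Rightarrow> 'b) / sqrt (2 ^ A i)) + ennreal (2 / v i))"
proof -
  let ?jump = "jump :: nat \<Rightarrow> walsh_group \<Rightarrow> 'b"
  let ?N = "A i"
  have "root_mass (walsh_convolution (fejer_sum m) (?jump ?N)) = root_mass (\<lambda>x. ((weight ?N)\<^sup>2 * 2 ^ ?N) * fejer_sum m x)"
    unfolding root_mass_def
    using n by (simp add: walsh_convolution_jump cylinder_fejer_sum norm_of_real del: of_real_mult weight_A)
  also have "\<dots> = sqrt (2 ^ ?N) * (1 / v i) * root_mass (fejer_sum m)"
    unfolding root_mass_mult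
    using v_pos[of i] by (simp add: real_sqrt_mult real_sqrt_divide power_divide abs_mult)
  finally have rm: "root_mass (walsh_convolution (fejer_sum m) (?jump ?N)) / sqrt (real n)
      = sqrt (2 ^ ?N) / sqrt (real n) * (root_mass (fejer_sum m) / v i)" by simp
  have "2 / 3 \<le> sqrt (2 ^ ?N) / sqrt (real n)"
  proof -
    have "real n = 2 ^ ?N + real m" "real m < 2 ^ ?N" "(0::real) < 2 ^ ?N"
      using n by simp_all
    then have "4 / 9 * real n \<le> 2 ^ ?N" "0 < real n" by linarith+
    then have "4 / 9 \<le> 2 ^ ?N / real n" by (simp add: le_divide_eq)
    then have "2 / 3 \<le> sqrt (2 ^ ?N / real n)" by (intro real_le_rsqrt) (simp add: power2_eq_square)
    then show ?thesis by (simp add: real_sqrt_divide)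
  qed
  moreover have "1 / 24 \<le> root_mass (fejer_sum m) / v i"
  proof -
    have "v i / 4 \<le> v i / 2 - 2" using v(2) by simp
    also have "\<dots> \<le> real (card (rises m))" using rises_remove_top_card[OF n] v(1) by simp
    finally have "v i / 24 \<le> root_mass (fejer_sum m)"
      using root_mass_fejer_sum_ge_rises[of m] by simp
    then show ?thesis using v_pos[of i] by (simp add: field_simps)
  qed
  ultimately have "2 / 3 * (1 / 24) \<le> sqrt (2 ^ ?N) / sqrt (real n) * (root_mass (fejer_sum m) / v i)"
    by (intro mult_mono) auto
  then have "ennreal (1 / 36) \<le> ennreal (root_mass (walsh_convolution (fejer_sum m) (?jump ?N)) / sqrt (real n))"
    unfolding rm by (intro ennreal_leI) simp
  also note root_mass_main_term_le[OF n]
  also note tail_lacunary_at_A_le[of i]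
  finally show ?thesis by (simp add: add_left_mono)
qed

end

text \<open>
  Among the finitely many indices whose level does not exceed that of a given one, take a maximiser.
\<close>

lemma record_index_exists:
  fixes V :: "nat \<Rightarrow> real" and N :: "nat \<Rightarrow> nat"
  assumes "filterlim N at_top sequentially" "\<not> bdd_above (range V)"
  shows "\<exists>a. M \<le> V a \<and> (\<forall>k. N k \<le> N a \<longrightarrow> V k \<le> V a)"
proof -
  obtain k0 where k0: "M < V k0"
    using assms(2) by (auto simp: bdd_above_def not_le)
  have "\<forall>\<^sub>F k in sequentially. Suc (N k0) \<le> N k"
    using assms(1) by (simp add: filterlim_at_top)
  then obtain K where K: "\<And>k. K \<le> k \<Longrightarrow> Suc (N k0) \<le> N k"
    by (auto simp: eventually_sequentially)
  define S where "S = {k. N k \<le> N k0}"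
  have "k < K" if "k \<in> S" for k
    using K[of k] that by (fastforce simp: S_def not_less_eq_eq)
  then have "S \<subseteq> {..<K}" by blast
  then have fin: "finite S" by (rule finite_subset) simp
  have "k0 \<in> S" by (simp add: S_def)
  then have "Max (V ` S) \<in> V ` S" using fin by (intro Max_in) auto
  then obtain a where a: "a \<in> S" "Max (V ` S) = V a" by blast
  have max: "V k \<le> V a" if "k \<in> S" for k
    using Max_ge[of "V ` S" "V k"] fin that a(2) by simp
  show ?thesis
  proof (intro exI conjI allI impI)
    show "M \<le> V a" using max[OF \<open>k0 \<in> S\<close>] k0 by simp
    fix k assume "N k \<le> N a"
    then have "k \<in> S" using a(1) by (simp add: S_def)
    then show "V k \<le> V a" by (rule max)
  qed
qed

text \<open>
  Between two chosen levels the modulus is governed by the next chosen index, whose variation is at least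
  that of all indices before it; therefore choosing records gives the bound for every \<open>k\<close>.
\<close>

theorem fejer_means_diverge:
  fixes n :: "nat \<Rightarrow> nat"
  assumes n: "strict_mono n" "\<And>k. 0 < n k"
    and unbdd: "\<not> bdd_above (range (\<lambda>k. variation (n k)))"
  obtains F :: "nat \<Rightarrow> walsh_group \<Rightarrow> 'b::{real_normed_field, banach, second_countable_topology}"
  where "F \<in> hardy_space (1 / 2)"
    and "(\<lambda>k. enn2real (Hp_modulus (1 / 2) (binary_order (n k)) F))
      \<in> O(\<lambda>k. 1 / (variation (n k))\<^sup>2)"
    and "\<not> (\<lambda>k. Lp_norm (1 / 2) (\<lambda>x. ennreal (norm (fejer_mean (n k) F x - limit_function F x))))
      \<longlonglongrightarrow> 0"
proof -
  define N where "N k = binary_order (n k)" for k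
  define V where "V k = variation (n k)" for k
  have V: "1 \<le> V k" for k unfolding V_def by (rule variation_ge_1[OF n(2)])
  have N: "filterlim N at_top sequentially"
    unfolding N_def by (rule filterlim_binary_order[OF n])
  have records: "\<exists>a. M \<le> V a \<and> (\<forall>k. N k \<le> N a \<longrightarrow> V k \<le> V a)" for M
    unfolding V_def by (rule record_index_exists[OF N unbdd])
  have "\<exists>\<alpha>. \<forall>i. (8 \<le> V (\<alpha> i) \<and> (\<forall>k. N k \<le> N (\<alpha> i) \<longrightarrow> V k \<le> V (\<alpha> i)))
      \<and> 2 * V (\<alpha> i) \<le> V (\<alpha> (Suc i))"
  proof (rule dependent_nat_choice)
    show "\<exists>a. 8 \<le> V a \<and> (\<forall>k. N k \<le> N a \<longrightarrow> V k \<le> V a)" by (rule records)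
    fix a :: nat
    assume "8 \<le> V a \<and> (\<forall>k. N k \<le> N a \<longrightarrow> V k \<le> V a)"
    moreover obtain a' where "2 * V a \<le> V a'" "\<forall>k. N k \<le> N a' \<longrightarrow> V k \<le> V a'"
      using records by blast
    ultimately show "\<exists>a'. (8 \<le> V a' \<and> (\<forall>k. N k \<le> N a' \<longrightarrow> V k \<le> V a')) \<and> 2 * V a \<le> V a'"
      by (intro exI[of _ a']) auto
  qed
  then obtain \<alpha> where \<alpha>: "\<And>i. 8 \<le> V (\<alpha> i)" "\<And>i k. N k \<le> N (\<alpha> i) \<Longrightarrow> V k \<le> V (\<alpha> i)"
      "\<And>i. 2 * V (\<alpha> i) \<le> V (\<alpha> (Suc i))"
    by blast
  define A where "A i = N (\<alpha> i)" for i
  define v where "v i = V (\<alpha> i)" for i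
  (* a record with a larger variation cannot lie at the same or a lower level *)
  have "A i < A (Suc i)" for i
  proof (rule ccontr)
    assume "\<not> A i < A (Suc i)"
    then have "V (\<alpha> (Suc i)) \<le> V (\<alpha> i)" by (intro \<alpha>(2)) (simp add: A_def)
    then show False using \<alpha>(1)[of i] \<alpha>(3)[of i] by simp
  qed
  then have A: "strict_mono A" by (simp add: strict_mono_Suc_iff)
  have v8: "8 \<le> v i" for i by (simp add: v_def \<alpha>(1))
  interpret lacunary_weights A v
    using A v8 \<alpha>(3) by unfold_locales (auto simp: v_def intro: less_le_trans[of 0 8])
  define F :: "nat \<Rightarrow> walsh_group \<Rightarrow> 'b" where "F = lacunary"
  define E where "E k = root_integral (\<lambda>x. fejer_mean (n k) F x - limit_function F x)" for k
  show thesis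
  proof (rule that)
    show "F \<in> hardy_space (1 / 2)" unfolding F_def by (rule lacunary_hardy)
    show "(\<lambda>k. enn2real (Hp_modulus (1 / 2) (binary_order (n k)) F)) \<in> O(\<lambda>k. 1 / (variation (n k))\<^sup>2)"
    proof (rule bigoI, rule always_eventually, rule allI)
      fix k
      have "(\<integral>\<^sup>+ x. tail_root F (N k) x \<partial>haar) \<le> ennreal (2 / V k)"
        unfolding F_def
        by (rule tail_lacunary_le) (use V[of k] \<alpha>(2) in \<open>auto simp: A_def v_def\<close>)
      then have "Hp_modulus (1 / 2) (N k) F \<le> ennreal_powr (ennreal (2 / V k)) 2"
        unfolding Hp_modulus_half by (rule ennreal_powr_mono[rotated]) simp
      also have "\<dots> = ennreal ((2 / V k)\<^sup>2)"
        using V[of k] by (intro ennreal_powr_2) simp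
      finally have "enn2real (Hp_modulus (1 / 2) (N k) F) \<le> (2 / V k)\<^sup>2"
        by (intro enn2real_leI) simp_all
      then show "norm (enn2real (Hp_modulus (1 / 2) (binary_order (n k)) F))
          \<le> 4 * norm (1 / (variation (n k))\<^sup>2)"
        by (simp add: N_def V_def power_divide)
    qed
    show "\<not> (\<lambda>k. Lp_norm (1 / 2) (\<lambda>x. ennreal (norm (fejer_mean (n k) F x - limit_function F x)))) \<longlonglongrightarrow> 0"
    proof
      (* three error terms below 1/200 contradict the lower bound 1/36 *)
      assume "(\<lambda>k. Lp_norm (1 / 2) (\<lambda>x. ennreal (norm (fejer_mean (n k) F x - limit_function F x)))) \<longlonglongrightarrow> 0"
      then have "\<forall>\<^sub>F k in sequentially. ennreal_powr (E k) 2 < ennreal ((1 / 200)\<^sup>2)"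
        unfolding Lp_norm_half E_def by (rule order_tendstoD) (simp add: power2_eq_square)
      then have "\<forall>\<^sub>F k in sequentially. E k < ennreal (1 / 200)"
      proof eventually_elim
        fix k assume *: "ennreal_powr (E k) 2 < ennreal ((1 / 200)\<^sup>2)"
        show "E k < ennreal (1 / 200)"
        proof (rule ccontr)
          assume "\<not> E k < ennreal (1 / 200)"
          then have "ennreal_powr (ennreal (1 / 200)) 2 \<le> ennreal_powr (E k) 2"
            by (intro ennreal_powr_mono) (auto simp: not_less)
          with * show False by (simp add: ennreal_powr_2 not_le[symmetric])
        qed
      qed
      then obtain K where K: "\<And>k. K \<le> k \<Longrightarrow> E k < ennreal (1 / 200)"
        by (auto simp: eventually_sequentially)
      define z where "z j = root_mass (dyadic_error j :: walsh_group \<Rightarrow> 'b) / sqrt (2 ^ j)" for j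
      have "z \<longlonglongrightarrow> 0"
        unfolding z_def by (rule root_mass_dyadic_error_tendsto_0[OF root_mass_g_tendsto_0])
      then have "(\<lambda>i. z (A i)) \<longlonglongrightarrow> 0"
        using A by (rule filterlim_compose[OF _ filterlim_subseq])
      then have "\<forall>\<^sub>F i in sequentially. z (A i) < 1 / 200" by (rule order_tendstoD) simp
      moreover have "\<forall>\<^sub>F i in sequentially. 2 / v i < 1 / 200"
        using inverse_v_tendsto_0 by (rule order_tendstoD) simp
      moreover have "\<forall>\<^sub>F i in sequentially. K \<le> \<alpha> i"
        (* the levels A i grow, so the indices leave every finite set *)
        using eventually_gt_at_top[of "Max (N ` {..K})"]
      proof eventually_elim
        fix i assume i: "Max (N ` {..K}) < i"
        show "K \<le> \<alpha> i"
        proof (rule ccontr)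
          assume "\<not> K \<le> \<alpha> i"
          then have "N (\<alpha> i) \<le> Max (N ` {..K})" by (intro Max_ge) auto
          moreover have "i \<le> N (\<alpha> i)"
            using strict_mono_imp_increasing[OF A, of i] by (simp add: A_def)
          ultimately show False using i by linarith
        qed
      qed
      ultimately have "\<forall>\<^sub>F i in sequentially. False"
      proof eventually_elim
        fix i assume i: "z (A i) < 1 / 200" "2 / v i < 1 / 200" "K \<le> \<alpha> i"
        obtain m where m: "n (\<alpha> i) = 2 ^ A i + m" "m < 2 ^ A i"
          unfolding A_def N_def using obtain_binary_order n(2) by blast
        have "ennreal (1 / 36) \<le> E (\<alpha> i) + (ennreal (z (A i)) + ennreal (2 / v i))"
          unfolding E_def F_def z_def
          by (rule fejer_error_lower_bound[OF m]) (use v8 in \<open>simp_all add: v_def V_def\<close>)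
        also have "\<dots> \<le> ennreal (1 / 200) + (ennreal (1 / 200) + ennreal (1 / 200))"
          using i K[OF i(3)] by (intro add_mono ennreal_leI) (auto simp: less_imp_le)
        also have "\<dots> = ennreal (3 / 200)"
          by (simp flip: ennreal_plus)
        finally show False by (subst (asm) ennreal_le_iff) simp_all
      qed
      then show False by simp
    qed
  qed
qed

theorem theorem3:
  fixes n :: "nat \<Rightarrow> nat"
  assumes "strict_mono n"
    and "\<And>k. n k > 0"
    and "\<not> bdd_above (range (\<lambda>k. variation (n k)))"
  shows
    "(\<forall>F :: nat \<Rightarrow> walsh_group \<Rightarrow> 'a::{real_normed_field, banach, second_countable_topology}.
        F \<in> hardy_space (1/2) \<longrightarrow>
        (\<lambda>k. enn2real (Hp_modulus (1/2) (binary_order (n k)) F))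
          \<in> o(\<lambda>k. 1 / (variation (n k))\<^sup>2) \<longrightarrow>
        (\<lambda>k. Lp_norm (1/2) (\<lambda>x. ennreal (norm (fejer_mean (n k) F x - limit_function F x))))
          \<longlonglongrightarrow> 0) \<and>
     (\<exists>F :: nat \<Rightarrow> walsh_group \<Rightarrow> 'a.
        F \<in> hardy_space (1/2) \<and>
        (\<lambda>k. enn2real (Hp_modulus (1/2) (binary_order (n k)) F))
          \<in> O(\<lambda>k. 1 / (variation (n k))\<^sup>2) \<and>
        \<not> (\<lambda>k. Lp_norm (1/2) (\<lambda>x. ennreal (norm (fejer_mean (n k) F x - limit_function F x))))
          \<longlonglongrightarrow> 0)"
  using fejer_means_converge[OF assms(1,2)]
    by (auto intro: fejer_means_diverge[OF assms])

end
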